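(* Let $k\geq 2$. The top homology group $\mathcal{T}_k = H_{k-1}(C^{(k)}_* )\cong \tilde H_{k-1}(\|\mathrm{Inj}_\bullet(k)\|;\mathbb{Z})$ of the complex of injective words is equal to the subgroup of $C^{(k)}_{k-1}$ spanned by $\mathcal{L}$-products. It has the following $\mathbb{Z}$-module basis: for any total order on $B := \bigcup_{S\subseteq [k], |S| \geq 2} B_S$, the set of polynomials $$P_1 P_2 \cdots P_m \qquad \text{such that } [k]=S_1 \sqcup S_2 \sqcup \cdots \sqcup S_m,\ P_i \in B_{S_i},\ \text{and } P_1 < P_2 < \cdots < P_m \text{ in } B.$$
   Context: $[k]=\{1,\dots,k\}$. The complex of injective words $\mathrm{Inj}_\bullet(k)$ is the augmented semi-simplicial set with $\mathrm{Inj}_q(k)$ ($q\ge -1$) the set of injective words of length $q+1$ in $[k]$ (i.e. words with no repeated letter; injections $\{0,\dots,q\}\to[k]$), with face map $d_j$ deleting the $j$th letter ($j=0,\dots,q$). $C^{(k)}_*$ is its reduced (augmented) integral cellular chain complex: $C^{(k)}_q$ is the free abelian group on injective words of length $q+1$, with differential $\sum_{j=0}^q(-1)^jd_j$. Since $C^{(k)}_k=0$, $\mathcal{T}_k=\ker(C^{(k)}_{k-1}\to C^{(k)}_{k-2})$. A (noncommutative) polynomial is an integer linear combination of words in $[k]$; words multiply by concatenation. The graded Lie bracket on words is $[a,b]=ab-(-1)^{|a||b|}ba$ ($|a|$ = word length), extended bilinearly. Lie polynomials are the elements of the smallest subgroup of the free abelian group on words containing the letters and closed under the bracket. For a finite set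 $S\subseteq[k]$ with $|S|\geq 2$, $\mathcal{L}_S$ is the group of homogeneous degree-$|S|$ Lie polynomials all of whose terms are injective words in $S$; $\mathcal{L}_S=0$ if $|S|\le 1$. $B_S$ denotes the set of the $(|S|-1)!$ elements $[[[\cdots[a_1,a_2],a_3],\ldots],a_{s}]$, where $s=|S|$, $a_1$ is the smallest element of $S$, and $(a_2,\dots,a_s)$ ranges over all orderings of $S\setminus\{a_1\}$. An element $P\in C^{(k)}_{k-1}$ is an $\mathcal{L}$-product if for some partition $[k]=S_1\sqcup\cdots\sqcup S_m$ it can be written $P=P_1P_2\cdots P_m$ with $P_i\in\mathcal{L}_{S_i}$ for each $i$. *)

theory Defs
  imports
    Complex_Main
    "HOL-Algebra.Free_Abelian_Groups"
    "HOL-Library.Disjoint_Sets"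
begin

section \<open>Noncommutative polynomials\<close>

text \<open>Words form a monoid under concatenation. Written additively, this makes the free abelian group
  \<^typ>\<open>'a list \<Rightarrow>\<^sub>0 int\<close> on words a ring whose multiplication extends concatenation
  bilinearly.\<close>

instantiation list :: (type) monoid_add
begin

definition zero_list :: "'a list" where "zero_list = []"

definition plus_list :: "'a list \<Rightarrow> 'a list \<Rightarrow> 'a list" where "plus_list u v = u @ v"

instance by standard (simp_all add: zero_list_def plus_list_def)

end

type_synonym ncpoly = "nat list \<Rightarrow>\<^sub>0 int"

lemma frag_of_times: "frag_of u * frag_of v = frag_of (u @ v)"
  by (simp add: mult_single plus_list_def)

lemma frag_of_Nil: "frag_of [] = 1"
  by (metis single_one zero_list_def)

global_interpretation frag: Modules.module "frag_cmul :: int \<Rightarrow> ('a \<Rightarrow>\<^sub>0 int) \<Rightarrow> ('a \<Rightarrow>\<^sub>0 int)"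
  by unfold_locales (simp_all add: frag_cmul_distrib frag_cmul_distrib2)

definition is_Z_basis :: "('a \<Rightarrow>\<^sub>0 int) set \<Rightarrow> ('a \<Rightarrow>\<^sub>0 int) set \<Rightarrow> bool" where
  "is_Z_basis X M \<longleftrightarrow> frag.independent X \<and> frag.span X = M"


section \<open>The complex of injective words\<close>

definition inj_words :: "nat \<Rightarrow> int \<Rightarrow> nat list set" where
  "inj_words k q = {w. distinct w \<and> set w \<subseteq> {1..k} \<and> int (length w) = q + 1}"

definition face :: "nat \<Rightarrow> 'a list \<Rightarrow> 'a list" where
  "face j w = take j w @ drop (Suc j) w"

abbreviation chain_gp :: "nat \<Rightarrow> int \<Rightarrow> ncpoly monoid" where
  "chain_gp k q \<equiv> free_Abelian_group (inj_words k q)"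

text \<open>The differential in all degrees at once; it vanishes on the empty word, which
  generates degree \<open>-1\<close>.\<close>

definition boundary :: "ncpoly \<Rightarrow> ncpoly" where
  "boundary = frag_extend (\<lambda>w. \<Sum>j<length w. frag_cmul ((-1) ^ j) (frag_of (face j w)))"

definition cycles :: "nat \<Rightarrow> int \<Rightarrow> ncpoly set" where
  "cycles k q = {P \<in> carrier (chain_gp k q). boundary P = 0}"

definition boundaries :: "nat \<Rightarrow> int \<Rightarrow> ncpoly set" where
  "boundaries k q = boundary ` carrier (chain_gp k (q + 1))"

definition cycle_gp :: "nat \<Rightarrow> int \<Rightarrow> ncpoly monoid" where
  "cycle_gp k q = (chain_gp k q)\<lparr>carrier := cycles k q\<rparr>"

definition homology_gp :: "nat \<Rightarrow> int \<Rightarrow> ncpoly set monoid" where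
  "homology_gp k q = cycle_gp k q Mod boundaries k q"

definition top_cycles :: "nat \<Rightarrow> ncpoly set" where
  "top_cycles k = cycles k (int k - 1)"


section \<open>Lie polynomials\<close>

definition bracket :: "ncpoly \<Rightarrow> ncpoly \<Rightarrow> ncpoly" where
  "bracket P Q = frag_extend (\<lambda>a. frag_extend (\<lambda>b.
     frag_of (a @ b) - frag_cmul ((-1) ^ (length a * length b)) (frag_of (b @ a))) Q) P"

inductive_set lie_polys :: "nat \<Rightarrow> ncpoly set" for k :: nat where
  letter: "i \<in> {1..k} \<Longrightarrow> frag_of [i] \<in> lie_polys k"
| zero: "0 \<in> lie_polys k"
| add: "P \<in> lie_polys k \<Longrightarrow> Q \<in> lie_polys k \<Longrightarrow> P + Q \<in> lie_polys k"
| minus: "P \<in> lie_polys k \<Longrightarrow> - P \<in> lie_polys k"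
| bracket: "P \<in> lie_polys k \<Longrightarrow> Q \<in> lie_polys k \<Longrightarrow> bracket P Q \<in> lie_polys k"

definition inj_lie :: "nat \<Rightarrow> nat set \<Rightarrow> ncpoly set" where
  "inj_lie k S = (if card S \<ge> 2
     then {P \<in> lie_polys k.
       \<forall>w \<in> Poly_Mapping.keys P. length w = card S \<and> distinct w \<and> set w \<subseteq> S}
     else {0})"

definition lie_basis :: "nat set \<Rightarrow> ncpoly set" where
  "lie_basis S = {foldl bracket (frag_of [Min S]) (map (\<lambda>a. frag_of [a]) as) | as.
     distinct as \<and> set as = S - {Min S}}"

definition all_lie_basis :: "nat \<Rightarrow> ncpoly set" where
  "all_lie_basis k = (\<Union>S \<in> {S. S \<subseteq> {1..k} \<and> card S \<ge> 2}. lie_basis S)"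


section \<open>Products of Lie polynomials\<close>

definition ordered_partition :: "'a set \<Rightarrow> 'a set list \<Rightarrow> bool" where
  "ordered_partition A Ss \<longleftrightarrow> distinct Ss \<and> partition_on A (set Ss)"

definition lie_products :: "nat \<Rightarrow> ncpoly set" where
  "lie_products k = {P \<in> carrier (chain_gp k (int k - 1)).
     \<exists>Ss Ps. ordered_partition {1..k} Ss \<and>
       list_all2 (\<lambda>Q S. Q \<in> inj_lie k S) Ps Ss \<and> P = prod_list Ps}"

text \<open>The order on \<^term>\<open>all_lie_basis k\<close> is given by its reflexive relation \<open>r\<close>.\<close>

definition increasing_products :: "nat \<Rightarrow> ncpoly rel \<Rightarrow> ncpoly set" where
  "increasing_products k r = {prod_list Ps | Ps Ss.
     ordered_partition {1..k} Ss \<and>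
     list_all2 (\<lambda>P S. card S \<ge> 2 \<and> P \<in> lie_basis S) Ps Ss \<and>
     sorted_wrt (\<lambda>P Q. (P, Q) \<in> r \<and> P \<noteq> Q) Ps}"

end

theory Submission
  imports Defs "HOL-Library.Multiset" "HOL-Library.List_Lexorder"
begin

text \<open>Order words lexicographically. A left-normed bracket of letters starting with its smallest
  letter has the corresponding word as its least term, with coefficient 1, so a product of such
  brackets with decreasing smallest letters has as its least term a word whose blocks between
  left-to-right minima have length at least two. Conversely, the least word of a nonzero top cycle
  has no block of length one: deleting the letter of such a block gives a face which no other word
  of the cycle has. Hence these products form a basis of the top cycles.

  Exchanging two adjacent factors of a product changes it, up to sign, by a product with the two
  factors replaced by their bracket, which has one factor less. So passing to another order of the
  factors is a unitriangular change of basis, up to signs, with respect to the number of factors.\<close>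

section \<open>Graded polynomials\<close>

text \<open>Products lie among the cycles because the differential is a graded derivation sending
  every letter to 1: on [a,b] = ab + ba it gives (b - a) + (a - b) = 0. Leading words settle only
  one order of the factors. If smallest letters increase somewhere, the concatenated word no longer
  splits back into the factors at its left-to-right minima, and different products share a least
  word: [1,2][3,4] and [[[1,2],3],4] both have 1234. Hence decreasing order serves as the reference.
  That order is not total on all brackets, since many share a smallest letter. But the factors of
  one product have disjoint letters, so it suffices to separate the factors within each product.
  Both orders are therefore encoded as integer keys that are injective on every such list. All
  pivots are 1 or -1, which keeps every elimination integral.\<close>

lemma frag_cmul_eq_of_int_times: "frag_cmul c P = of_int c * (P :: ncpoly)"
proof -
  have "of_int c = frag_cmul c (1 :: ncpoly)" for c
  proof (induction c rule: int_induct[of _ 0])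
    case (step1 i) then show ?case by (simp add: frag_cmul_distrib)
  next
    case (step2 i) then show ?case by (simp add: frag_cmul_diff_distrib)
  qed simp
  moreover have "frag_cmul c (1 :: ncpoly) * P = frag_cmul c P" for c
  proof (induction c rule: int_induct[of _ 0])
    case (step1 i) then show ?case by (simp add: frag_cmul_distrib algebra_simps)
  next
    case (step2 i) then show ?case by (simp add: frag_cmul_diff_distrib algebra_simps)
  qed simp
  ultimately show ?thesis by simp
qed

lemma frag_cmul_times_left: "frag_cmul c P * (Q :: ncpoly) = frag_cmul c (P * Q)"
  by (simp add: frag_cmul_eq_of_int_times mult.assoc)

lemma frag_cmul_times_right: "(P :: ncpoly) * frag_cmul c Q = frag_cmul c (P * Q)"
  by (metis frag_cmul_eq_of_int_times mult.assoc mult_of_int_commute)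

text \<open>The default orientation makes the cancellation simprocs loop.\<close>

declare minus_frag_cmul [simp del]

lemma frag_cmul_uminus [simp]: "frag_cmul (- c) P = - frag_cmul c P"
  by (rule minus_frag_cmul[symmetric])

text \<open>Zero is homogeneous of every degree, which also covers \<open>inj_lie k S = {0}\<close>
  for small \<open>S\<close>.\<close>

definition homogeneous :: "nat \<Rightarrow> ncpoly \<Rightarrow> bool" where
  "homogeneous n P \<longleftrightarrow> (\<forall>w \<in> Poly_Mapping.keys P. length w = n)"

lemma homogeneous_frag_of [simp]: "homogeneous n (frag_of w) \<longleftrightarrow> length w = n"
  by (simp add: homogeneous_def)

lemma homogeneous_diff: "homogeneous n P \<Longrightarrow> homogeneous n Q \<Longrightarrow> homogeneous n (P - Q)"
  using keys_diff[of P Q] unfolding homogeneous_def by blast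

lemma homogeneous_cmul: "homogeneous n P \<Longrightarrow> homogeneous n (frag_cmul c P)"
  by (auto simp: homogeneous_def)

lemma homogeneous_times:
  assumes "homogeneous m P" "homogeneous n Q"
  shows "homogeneous (m + n) (P * Q)"
  using keys_mult[of P Q] assms unfolding homogeneous_def plus_list_def by fastforce

lemma homogeneous_frag_extend:
  assumes "homogeneous n P" "\<And>w. length w = n \<Longrightarrow> homogeneous m (f w)"
  shows "homogeneous m (frag_extend f P)"
  using keys_frag_extend[of f P] assms unfolding homogeneous_def by blast

lemma homogeneous_induct [consumes 1, case_names zero word diff]:
  assumes "homogeneous n P" "p 0" "\<And>w. length w = n \<Longrightarrow> p (frag_of w)"
    "\<And>P Q. p P \<Longrightarrow> p Q \<Longrightarrow> p (P - Q)"
  shows "p P"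
  by (rule frag_induction[of P "{w. length w = n}"])
    (use assms in \<open>auto simp: homogeneous_def\<close>)


section \<open>The differential is a graded derivation\<close>

lemma boundary_zero [simp]: "boundary 0 = 0"
  and boundary_add: "boundary (P + Q) = boundary P + boundary Q"
  and boundary_diff: "boundary (P - Q) = boundary P - boundary Q"
  and boundary_minus: "boundary (- P) = - boundary P"
  and boundary_cmul: "boundary (frag_cmul c P) = frag_cmul c (boundary P)"
  by (simp_all add: boundary_def frag_extend_add frag_extend_diff frag_extend_cmul
      frag_extend_minus)

lemma boundary_frag_of:
  "boundary (frag_of w) = (\<Sum>j<length w. frag_cmul ((-1) ^ j) (frag_of (face j w)))"
  by (simp add: boundary_def)

lemma boundary_one [simp]: "boundary 1 = 0"
  using boundary_frag_of[of "[]"] by (simp add: frag_of_Nil)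

text \<open>A later letter sits one position further right than in \<open>w\<close>, whence the
  minus sign; iterating this recursion gives the Leibniz rule.\<close>

lemma boundary_Cons:
  "boundary (frag_of (x # w)) = frag_of w - frag_of [x] * boundary (frag_of w)"
proof -
  let ?g = "\<lambda>j. frag_cmul ((-1) ^ j) (frag_of (face j (x # w)))"
  have g: "?g (Suc j) = - (frag_of [x] * frag_cmul ((-1) ^ j) (frag_of (face j w)))" for j
  proof -
    have "face (Suc j) (x # w) = [x] @ face j w" by (simp add: face_def)
    then have *: "frag_of (face (Suc j) (x # w)) = frag_of [x] * frag_of (face j w)"
      by (simp only: frag_of_times)
    show ?thesis
      unfolding * frag_cmul_times_right by (simp only: power_Suc mult_minus1 frag_cmul_uminus)
  qed
  have "boundary (frag_of (x # w)) = (\<Sum>j<Suc (length w). ?g j)"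
    by (simp only: boundary_frag_of length_Cons)
  also have "\<dots> = ?g 0 + (\<Sum>j<length w. ?g (Suc j))"
    by (rule sum.lessThan_Suc_shift)
  also have "?g 0 = frag_of w" by (simp add: face_def)
  also have "(\<Sum>j<length w. ?g (Suc j)) = - (frag_of [x] * boundary (frag_of w))"
    unfolding g boundary_frag_of sum_distrib_left sum_negf ..
  finally show ?thesis by simp
qed

lemma boundary_letter: "boundary (frag_of [x]) = 1"
  by (simp add: boundary_Cons frag_of_Nil)

text \<open>The truncated \<open>n - 1\<close> is harmless at \<open>n = 0\<close>: the boundary of
  the empty word is an empty sum.\<close>

lemma homogeneous_boundary:
  assumes "homogeneous n P"
  shows "homogeneous (n - 1) (boundary P)"
  unfolding boundary_def
proof (rule homogeneous_frag_extend[OF assms])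
  fix w :: "nat list" assume "length w = n"
  then show "homogeneous (n - 1) (\<Sum>j<length w. frag_cmul ((- 1) ^ j) (frag_of (face j w)))"
    using keys_sum[of "\<lambda>j. frag_cmul ((- 1) ^ j) (frag_of (face j w))" "{..<length w}"]
    by (fastforce simp: homogeneous_def face_def)
qed

lemma boundary_append:
  "boundary (frag_of (u @ v)) = boundary (frag_of u) * frag_of v
     + frag_cmul ((-1) ^ length u) (frag_of u * boundary (frag_of v))"
proof (induction u)
  case Nil
  then show ?case by (simp add: frag_of_Nil)
next
  case (Cons x u)
  have xu: "frag_of (x # u) = frag_of [x] * frag_of u" by (simp only: frag_of_times append.simps)
  have "boundary (frag_of (x # u @ v)) = frag_of u * frag_of v - frag_of [x] *
      (boundary (frag_of u) * frag_of v + frag_cmul ((-1) ^ length u) (frag_of u * boundary (frag_of v)))"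
    by (simp only: boundary_Cons Cons.IH frag_of_times)
  also have "\<dots> = boundary (frag_of (x # u)) * frag_of v
      + frag_cmul ((-1) ^ length (x # u)) (frag_of (x # u) * boundary (frag_of v))"
    unfolding boundary_Cons unfolding xu
    by (simp add: left_diff_distrib distrib_left frag_cmul_times_right mult.assoc diff_diff_eq)
  finally show ?case by (simp only: append_Cons)
qed

lemma boundary_times:
  assumes "homogeneous p P"
  shows "boundary (P * Q) = boundary P * Q + frag_cmul ((-1) ^ p) (P * boundary Q)"
  using assms
proof (induction rule: homogeneous_induct)
  case (word u)
  show ?case
    by (rule frag_induction[of Q UNIV])
      (simp_all add: frag_of_times boundary_append word boundary_diff algebra_simps
        frag_cmul_eq_of_int_times)
qed (simp_all add: boundary_diff algebra_simps frag_cmul_eq_of_int_times)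


section \<open>The graded bracket\<close>

lemma bracket_add_left: "bracket (P + P') Q = bracket P Q + bracket P' Q"
  and bracket_diff_left: "bracket (P - P') Q = bracket P Q - bracket P' Q"
  and bracket_cmul_left: "bracket (frag_cmul c P) Q = frag_cmul c (bracket P Q)"
  and bracket_zero_left [simp]: "bracket 0 Q = 0"
  by (simp_all add: bracket_def frag_extend_add frag_extend_diff frag_extend_cmul)

lemma bracket_eq:
  assumes "homogeneous p P" "homogeneous q Q"
  shows "bracket P Q = P * Q - frag_cmul ((-1) ^ (p * q)) (Q * P)"
  using assms(1)
proof (induction rule: homogeneous_induct)
  case (word u)
  show ?case
    using assms(2)
  proof (induction rule: homogeneous_induct)
    case (word v)
    then show ?case using \<open>length u = p\<close> by (simp add: bracket_def frag_of_times)
  qed (simp_all add: bracket_def frag_extend_diff algebra_simps frag_cmul_eq_of_int_times)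
qed (simp_all add: bracket_diff_left algebra_simps frag_cmul_eq_of_int_times)

text \<open>\<open>Q\<close> sits inside the function that is extended over \<open>P\<close>, so the
  outer extension is unfolded into a finite sum over the keys of \<open>P\<close>.\<close>

lemma bracket_add_right: "bracket P (Q + Q') = bracket P Q + bracket P Q'"
  and bracket_cmul_right: "bracket P (frag_cmul c Q) = frag_cmul c (bracket P Q)"
  and bracket_zero_right [simp]: "bracket P 0 = 0"
proof -
  show "bracket P (Q + Q') = bracket P Q + bracket P Q'"
    by (simp add: bracket_def frag_extend_add frag_extend_def[of _ P] frag_cmul_distrib2
        sum.distrib)
  show "bracket P (frag_cmul c Q) = frag_cmul c (bracket P Q)"
    by (simp add: bracket_def frag_extend_cmul frag_extend_def[of _ P] frag_cmul_sum
        mult.commute)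
  show "bracket P 0 = 0" by (simp add: bracket_def frag_extend_def[of _ P])
qed

lemma homogeneous_bracket:
  assumes "homogeneous p P" "homogeneous q Q"
  shows "homogeneous (p + q) (bracket P Q)"
  using homogeneous_times[OF assms] homogeneous_times[OF assms(2,1)]
  by (simp add: bracket_eq[OF assms] homogeneous_diff homogeneous_cmul add.commute)

lemma bracket_antisym:
  assumes "homogeneous p P" "homogeneous q Q"
  shows "bracket P Q = frag_cmul (- ((-1) ^ (p * q))) (bracket Q P)"
  by (cases "even p"; cases "even q")
    (simp_all add: bracket_eq[OF assms] bracket_eq[OF assms(2,1)])

text \<open>The graded Jacobi identity solved for the nested bracket. \<open>Y\<close> will be a
  single letter, so only the parities of \<open>p\<close> and \<open>q\<close> are left to
  check.\<close>

lemma bracket_Jacobi: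
  assumes P: "homogeneous p P" and X: "homogeneous q X" and Y: "homogeneous 1 Y"
  shows "bracket P (bracket X Y)
    = bracket (bracket P X) Y - frag_cmul ((-1) ^ q) (bracket (bracket P Y) X)"
proof -
  note h = homogeneous_bracket
  show ?thesis
    unfolding bracket_eq[OF P h[OF X Y]] bracket_eq[OF h[OF P X] Y] bracket_eq[OF h[OF P Y] X]
    unfolding bracket_eq[OF X Y] bracket_eq[OF P X] bracket_eq[OF P Y]
    by (cases "even p"; cases "even q") (simp_all add: algebra_simps)
qed


section \<open>Lie polynomials of degree at least two are cycles\<close>

text \<open>Homogeneous polynomials that behave like Lie monomials under the differential.\<close>

definition lie_like :: "ncpoly set" where
  "lie_like = {P. \<exists>p c. homogeneous p P \<and> boundary P = frag_cmul c 1 \<and> (c \<noteq> 0 \<longrightarrow> p = 1)}"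

text \<open>By Leibniz the boundary contains \<open>Q\<close> with coefficient c (1 - (-1)^(pq + q))
  and \<open>P\<close> with coefficient d ((-1)^p - (-1)^(pq)). The first vanishes for p = 1 and the
  second for q = 1, which is why \<open>lie_like\<close> ties nonzero constants to degree 1.\<close>

lemma bracket_lie_like:
  assumes "P \<in> lie_like" "Q \<in> lie_like"
  shows "bracket P Q \<in> lie_like"
proof -
  obtain p c where P: "homogeneous p P" "boundary P = frag_cmul c 1" "c \<noteq> 0 \<longrightarrow> p = 1"
    using assms(1) unfolding lie_like_def by blast
  obtain q d where Q: "homogeneous q Q" "boundary Q = frag_cmul d 1" "d \<noteq> 0 \<longrightarrow> q = 1"
    using assms(2) unfolding lie_like_def by blast
  have "boundary (bracket P Q) = 0"
    using P(3) Q(3)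
    by (cases "c = 0"; cases "d = 0"; cases "even p"; cases "even q")
      (simp_all add: bracket_eq[OF P(1) Q(1)] boundary_diff boundary_minus boundary_cmul
        boundary_add boundary_times[OF P(1)]
        boundary_times[OF Q(1)] P(2) Q(2) frag_cmul_times_left frag_cmul_times_right)
  with homogeneous_bracket[OF P(1) Q(1)] show ?thesis
    unfolding lie_like_def by force
qed

lemma linear_image_span:
  assumes add: "\<And>x y. f (x + y) = f x + f y" and cmul: "\<And>c x. f (frag_cmul c x) = frag_cmul c (f x)"
    and gen: "\<And>x. x \<in> X \<Longrightarrow> f x \<in> frag.span Y" and x: "x \<in> frag.span X"
  shows "f x \<in> frag.span Y"
  using x
proof (induction rule: frag.span_induct_alt)
  case base
  have "f 0 = 0" using cmul[of 0 0] by simp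
  then show ?case by (simp add: frag.span_zero)
next
  case (step c x y)
  then show ?case by (simp add: add cmul frag.span_add frag.span_scale gen)
qed

text \<open>Sums may mix degrees and leave \<open>lie_like\<close>, so the induction runs in its
  span; bilinearity extends \<open>bracket_lie_like\<close> one argument at a time.\<close>

lemma lie_polys_subset_span: "P \<in> lie_polys k \<Longrightarrow> P \<in> frag.span lie_like"
proof (induction rule: lie_polys.induct)
  case (letter i)
  have "frag_of [i] \<in> lie_like"
    unfolding lie_like_def
    by (intro CollectI exI[of _ 1] exI[of _ "1::int"]) (simp add: boundary_letter)
  then show ?case by (rule frag.span_base)
next
  case (bracket P Q)
  have "bracket P' Q \<in> frag.span lie_like" if P': "P' \<in> lie_like" for P'
    by (rule linear_image_span[OF bracket_add_right bracket_cmul_right _ bracket.IH(2)])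
      (rule frag.span_base[OF bracket_lie_like[OF P']])
  then show ?case
    by (rule linear_image_span[of "\<lambda>P. bracket P Q", OF bracket_add_left bracket_cmul_left _
          bracket.IH(1)])
qed (simp_all add: frag.span_zero frag.span_add frag.span_neg)

lemma boundary_lie_poly:
  assumes "P \<in> lie_polys k"
  obtains c where "boundary P = frag_cmul c 1"
proof -
  have "boundary P \<in> frag.span {1}"
    using lie_polys_subset_span[OF assms]
  proof (rule linear_image_span[OF boundary_add boundary_cmul, rotated])
    fix x assume "x \<in> lie_like"
    then obtain c where "boundary x = frag_cmul c 1" unfolding lie_like_def by blast
    then show "boundary x \<in> frag.span {1}" by (simp add: frag.span_scale frag.span_base)
  qed
  then show thesis
    using that by (auto simp: frag.span_singleton)
qed

lemma homogeneous_inj_lie: "P \<in> inj_lie k S \<Longrightarrow> homogeneous (card S) P"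
  by (auto simp: inj_lie_def homogeneous_def split: if_splits)

text \<open>The boundary is a constant, yet homogeneous of degree \<open>card S - 1\<close>, which
  is positive.\<close>

lemma boundary_inj_lie:
  assumes "P \<in> inj_lie k S"
  shows "boundary P = 0"
proof (cases "card S \<ge> 2")
  case True
  with assms have P: "P \<in> lie_polys k" by (simp add: inj_lie_def)
  obtain c where c: "boundary P = frag_cmul c 1"
    using boundary_lie_poly[OF P] .
  have "homogeneous (card S - 1) (frag_cmul c 1)"
    using homogeneous_boundary[OF homogeneous_inj_lie[OF assms]] c by simp
  with True have "c = 0"
    by (auto simp: homogeneous_def simp flip: frag_of_Nil)
  with c show ?thesis by simp
qed (use assms in \<open>simp add: inj_lie_def\<close>)

lemma boundary_prod_list_cycles:
  assumes "\<forall>P\<in>set Ps. boundary P = 0 \<and> (\<exists>p. homogeneous p P)"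
  shows "boundary (prod_list Ps) = 0"
  using assms by (induction Ps) (auto simp: boundary_times)

lemma lie_products_subset_cycles: "lie_products k \<subseteq> top_cycles k"
proof
  fix P assume "P \<in> lie_products k"
  then obtain Ss Ps where P: "P \<in> carrier (chain_gp k (int k - 1))"
    and *: "list_all2 (\<lambda>Q S. Q \<in> inj_lie k S) Ps Ss" and "P = prod_list Ps"
    unfolding lie_products_def by blast
  moreover have "\<forall>Q\<in>set Ps. boundary Q = 0 \<and> (\<exists>p. homogeneous p Q)"
    using * homogeneous_inj_lie boundary_inj_lie
    by (metis in_set_conv_nth list_all2_conv_all_nth)
  ultimately show "P \<in> top_cycles k"
    by (simp add: top_cycles_def cycles_def boundary_prod_list_cycles)
qed

lemma span_top_cycles: "frag.span (top_cycles k) = top_cycles k"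
proof (subst frag.span_eq_iff, rule frag.subspaceI)
  fix P Q c assume "P \<in> top_cycles k" "Q \<in> top_cycles k"
  then show "P + Q \<in> top_cycles k" "frag_cmul c P \<in> top_cycles k"
    using keys_add[of P Q] keys_cmul[of c P]
    by (auto simp: top_cycles_def cycles_def boundary_add boundary_cmul)
qed (simp add: top_cycles_def cycles_def)


section \<open>Left-normed brackets\<close>

text \<open>Basis brackets are indexed by words, so that sorting, disjointness and leading terms
  become statements about lists.\<close>

fun left_normed :: "nat list \<Rightarrow> ncpoly" where
  "left_normed [] = 0"
| "left_normed (a # w) = foldl bracket (frag_of [a]) (map (\<lambda>b. frag_of [b]) w)"

text \<open>These words index the union of the sets \<open>B_S\<close>.\<close>

fun lie_word :: "nat list \<Rightarrow> bool" where
  "lie_word [] = False"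
| "lie_word (a # w) \<longleftrightarrow> w \<noteq> [] \<and> distinct w \<and> (\<forall>b\<in>set w. a < b)"

lemma homogeneous_foldl_bracket:
  "homogeneous p P \<Longrightarrow>
    homogeneous (p + length w) (foldl bracket P (map (\<lambda>b. frag_of [b]) w))"
proof (induction w arbitrary: p P)
  case (Cons a w)
  then show ?case using homogeneous_bracket[of p P 1 "frag_of [a]"] by fastforce
qed simp

lemma homogeneous_left_normed: "homogeneous (length w) (left_normed w)"
proof (cases w)
  case (Cons a v)
  then show ?thesis using homogeneous_foldl_bracket[of 1 "frag_of [a]" v] by simp
qed (simp add: homogeneous_def)

lemma left_normed_append:
  "u \<noteq> [] \<Longrightarrow> left_normed (u @ w) = foldl bracket (left_normed u) (map (\<lambda>b. frag_of [b]) w)"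
  by (cases u) simp_all

text \<open>Induction on \<open>w\<close>: the Jacobi identity moves the last letter of \<open>w\<close> out of the bracket.\<close>

lemma bracket_left_normed_span:
  assumes "homogeneous p P"
  shows "bracket P (left_normed w)
    \<in> frag.span {foldl bracket P (map (\<lambda>b. frag_of [b]) cs) | cs. mset cs = mset w}"
  using assms
proof (induction w arbitrary: p P rule: rev_induct)
  case Nil
  then show ?case by (simp add: frag.span_zero)
next
  case (snoc c w)
  let ?F = "\<lambda>P w. {foldl bracket P (map (\<lambda>b. frag_of [b]) cs) | cs. mset cs = mset w}"
  let ?X = "left_normed w" and ?c = "frag_of [c]"
  show ?case
  proof (cases "w = []")
    case True
    have "foldl bracket P (map (\<lambda>b. frag_of [b]) [c]) \<in> ?F P [c]" by blast
    with True show ?thesis by (auto intro: frag.span_base)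
  next
    case False
    have "bracket (bracket P ?X) ?c \<in> frag.span (?F P (w @ [c]))"
    proof (rule linear_image_span[of "\<lambda>Q. bracket Q ?c", OF bracket_add_left bracket_cmul_left _
          snoc.IH[OF snoc.prems]])
      fix x assume "x \<in> ?F P w"
      then obtain cs where "x = foldl bracket P (map (\<lambda>b. frag_of [b]) cs)" "mset cs = mset w"
        by blast
      then have "bracket x ?c = foldl bracket P (map (\<lambda>b. frag_of [b]) (cs @ [c]))"
        "mset (cs @ [c]) = mset (w @ [c])" by simp_all
      then show "bracket x ?c \<in> frag.span (?F P (w @ [c]))"
        by (blast intro: frag.span_base)
    qed
    moreover have "bracket (bracket P ?c) ?X \<in> frag.span (?F P (w @ [c]))"
    proof -
      have "?F (bracket P ?c) w \<subseteq> ?F P (w @ [c])"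
      proof
        fix x assume "x \<in> ?F (bracket P ?c) w"
        then obtain cs where "x = foldl bracket P (map (\<lambda>b. frag_of [b]) (c # cs))"
          "mset (c # cs) = mset (w @ [c])" by auto
        then show "x \<in> ?F P (w @ [c])" by blast
      qed
      \<comment> \<open>Here the induction hypothesis is applied with \<open>bracket P ?c\<close>,
        of degree \<open>p + 1\<close>, in place of \<open>P\<close>.\<close>
      moreover have "bracket (bracket P ?c) ?X \<in> frag.span (?F (bracket P ?c) w)"
        by (rule snoc.IH[OF homogeneous_bracket[OF snoc.prems, of 1]]) simp
      ultimately show ?thesis using frag.span_mono by blast
    qed
    moreover have "left_normed (w @ [c]) = bracket ?X ?c"
      using False by (simp add: left_normed_append)
    ultimately show ?thesis
      using bracket_Jacobi[OF snoc.prems homogeneous_left_normed, of ?c w]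
      by (simp add: frag.span_diff frag.span_scale del: map_append)
  qed
qed

text \<open>By antisymmetry \<open>u\<close> may be taken to contain the overall smallest letter.
  Expanding the bracket then appends rearrangements of \<open>v\<close> to \<open>u\<close>, so
  every resulting word still starts with that letter.\<close>

lemma bracket_lie_words:
  assumes "lie_word u" "lie_word v" "set u \<inter> set v = {}"
  shows "bracket (left_normed u) (left_normed v)
    \<in> frag.span (left_normed ` {w. lie_word w \<and> set w = set u \<union> set v})"
proof -
  have *: "bracket (left_normed u) (left_normed v)
      \<in> frag.span (left_normed ` {w. lie_word w \<and> set w = set u \<union> set v})"
    if uv: "lie_word u" "lie_word v" "set u \<inter> set v = {}" "hd u < hd v" for u v
  proof -
    have "foldl bracket (left_normed u) (map (\<lambda>b. frag_of [b]) cs)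
        \<in> left_normed ` {w. lie_word w \<and> set w = set u \<union> set v}" if "mset cs = mset v" for cs
    proof
      have cs: "set cs = set v" "distinct cs \<longleftrightarrow> distinct v"
        using that by (metis set_mset_mset) (metis that mset_eq_imp_distinct_iff)
      show "foldl bracket (left_normed u) (map (\<lambda>b. frag_of [b]) cs) = left_normed (u @ cs)"
        using uv by (cases u) auto
      show "u @ cs \<in> {w. lie_word w \<and> set w = set u \<union> set v}"
        using uv cs by (cases u; cases v) auto
    qed
    then show ?thesis
      using bracket_left_normed_span[OF homogeneous_left_normed, of u v]
      by (smt (verit) frag.span_mono mem_Collect_eq subset_iff)
  qed
  have "hd u \<noteq> hd v" using assms by (cases u; cases v) auto
  then consider "hd u < hd v" | "hd v < hd u" by linarith
  then show ?thesis
  proof cases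
    case 1
    then show ?thesis using assms * by blast
  next
    case 2
    then have "bracket (left_normed v) (left_normed u)
      \<in> frag.span (left_normed ` {w. lie_word w \<and> set w = set u \<union> set v})"
      using *[of v u] assms by (simp add: Un_commute Int_commute)
    then show ?thesis
      using bracket_antisym[OF homogeneous_left_normed homogeneous_left_normed]
      by (metis frag.span_scale)
  qed
qed


section \<open>Leading words\<close>

lemma append_less_append_iff:
  "length u = length u' \<Longrightarrow> u @ v < u' @ v' \<longleftrightarrow> u < u' \<or> u = u' \<and> v < (v' :: nat list)"
  by (induction u u' rule: list_induct2) auto

text \<open>Subtracting \<open>frag_of w\<close> expresses coefficient 1 and minimality in one
  condition. Lengths must agree because only between prefixes of equal length is the lexicographic
  order compatible with concatenation.\<close>

definition has_lead :: "nat list \<Rightarrow> ncpoly \<Rightarrow> bool" where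
  "has_lead w P \<longleftrightarrow> (\<forall>u \<in> Poly_Mapping.keys (P - frag_of w). length u = length w \<and> w < u)"

lemma has_lead_frag_of [simp]: "has_lead w (frag_of w)"
  by (simp add: has_lead_def)

lemma has_lead_lookup:
  assumes "has_lead w P"
  shows "poly_mapping.lookup P w = 1"
proof -
  have "w \<notin> Poly_Mapping.keys (P - frag_of w)" using assms by (auto simp: has_lead_def)
  then show ?thesis by (simp add: in_keys_iff lookup_minus)
qed

lemma has_lead_keys:
  assumes "has_lead w P" "u \<in> Poly_Mapping.keys P"
  shows "u = w \<or> length u = length w \<and> w < u"
proof (cases "u = w")
  case False
  then have "u \<in> Poly_Mapping.keys (P - frag_of w)"
    using assms(2) by (simp add: in_keys_iff lookup_minus)
  then show ?thesis using assms(1) by (simp add: has_lead_def)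
qed simp

lemma has_lead_lookup_less: "has_lead w P \<Longrightarrow> u < w \<Longrightarrow> poly_mapping.lookup P u = 0"
  using has_lead_keys[of w P u] by (metis in_keys_iff less_asym less_irrefl)

lemma has_lead_unique: "has_lead v P \<Longrightarrow> has_lead w P \<Longrightarrow> v = w"
  using has_lead_lookup has_lead_lookup_less by (metis linorder_neqE zero_neq_one)

section \<open>Leading words of products and brackets\<close>

lemma keys_times:
  assumes "w \<in> Poly_Mapping.keys (P * Q)"
  obtains u v where "u \<in> Poly_Mapping.keys P" "v \<in> Poly_Mapping.keys Q" "w = u @ v"
  using subsetD[OF keys_mult assms] by (auto simp: plus_list_def)

lemma keys_diff_cmul:
  "w \<in> Poly_Mapping.keys (P - frag_cmul c Q) \<Longrightarrow>
    w \<in> Poly_Mapping.keys P \<or> w \<in> Poly_Mapping.keys Q"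
  by (auto simp: in_keys_iff lookup_minus)

lemma has_lead_times:
  assumes "has_lead u P" "has_lead v Q"
  shows "has_lead (u @ v) (P * Q)"
  unfolding has_lead_def
proof
  fix w assume w: "w \<in> Poly_Mapping.keys (P * Q - frag_of (u @ v))"
  define P' Q' where "P' = P - frag_of u" and "Q' = Q - frag_of v"
  have P': "length a = length u \<and> u < a" if "a \<in> Poly_Mapping.keys P'" for a
    using assms(1) that by (simp add: has_lead_def P'_def)
  have Q': "length a = length v \<and> v < a" if "a \<in> Poly_Mapping.keys Q'" for a
    using assms(2) that by (simp add: has_lead_def Q'_def)
  have "P * Q - frag_of (u @ v) = frag_of u * Q' + P' * Q"
    by (simp add: P'_def Q'_def algebra_simps frag_of_times)
  with w have "w \<in> Poly_Mapping.keys (frag_of u * Q') \<union> Poly_Mapping.keys (P' * Q)"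
    using keys_add by (metis subsetD)
  then obtain a b where w: "w = a @ b" and
    "a = u \<and> b \<in> Poly_Mapping.keys Q' \<or> a \<in> Poly_Mapping.keys P' \<and> b \<in> Poly_Mapping.keys Q"
    by (elim UnE keys_times) auto
  then consider "a = u" "length b = length v" "v < b"
    | "length a = length u" "u < a" "length b = length v"
    using P'[of a] Q'[of b] has_lead_keys[OF assms(2), of b] by auto
  then show "length w = length (u @ v) \<and> u @ v < w"
    by cases (simp_all add: w append_less_append_iff)
qed

lemma keys_bracket:
  assumes "w \<in> Poly_Mapping.keys (bracket P Q)"
  obtains u v where "u \<in> Poly_Mapping.keys P" "v \<in> Poly_Mapping.keys Q" "w = u @ v \<or> w = v @ u"
proof -
  obtain u v where "u \<in> Poly_Mapping.keys P" "v \<in> Poly_Mapping.keys Q"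
    "w \<in> Poly_Mapping.keys (frag_of (u @ v)
        - frag_cmul ((-1) ^ (length u * length v)) (frag_of (v @ u)))"
    using assms unfolding bracket_def by (blast dest: subsetD[OF keys_frag_extend])
  then show thesis
    using that[of u v] keys_diff_cmul[of w "frag_of (u @ v)" _ "frag_of (v @ u)"] by auto
qed

lemma keys_foldl_bracket:
  assumes "\<And>u. u \<in> Poly_Mapping.keys P \<Longrightarrow> mset u = M"
    and "u \<in> Poly_Mapping.keys (foldl bracket P (map (\<lambda>b. frag_of [b]) w))"
  shows "mset u = M + mset w"
  using assms
proof (induction w arbitrary: P M)
  case (Cons b w)
  have "mset u = (M + {#b#}) + mset w"
  proof (rule Cons.IH)
    fix v assume "v \<in> Poly_Mapping.keys (bracket P (frag_of [b]))"
    then show "mset v = M + {#b#}"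
      by (rule keys_bracket) (use Cons.prems(1) in auto)
  qed (use Cons.prems(2) in simp)
  then show ?case by simp
qed simp

lemma keys_left_normed:
  assumes "u \<in> Poly_Mapping.keys (left_normed w)"
  shows "mset u = mset w"
proof (cases w)
  case (Cons a v)
  then show ?thesis using keys_foldl_bracket[of "frag_of [a]" "{#a#}" u v] assms by simp
qed (use assms in simp)

text \<open>All terms of the second half of the bracket start with \<open>b\<close>, which exceeds
  \<open>hd w\<close>, so whatever its sign it cannot affect the least word.\<close>

lemma has_lead_bracket_letter:
  assumes w: "has_lead w P" "w \<noteq> []" "hd w < b"
  shows "has_lead (w @ [b]) (bracket P (frag_of [b]))"
  unfolding has_lead_def
proof
  fix u assume u: "u \<in> Poly_Mapping.keys (bracket P (frag_of [b]) - frag_of (w @ [b]))"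
  have P: "homogeneous (length w) P"
    using has_lead_keys[OF w(1)] by (auto simp: homogeneous_def)
  define e :: int where "e = (-1) ^ (length w * 1)"
  have eq: "bracket P (frag_of [b]) - frag_of (w @ [b])
      = (P * frag_of [b] - frag_of (w @ [b])) - frag_cmul e (frag_of [b] * P)"
    using bracket_eq[OF P, of 1 "frag_of [b]"] by (simp add: e_def)
  have "u \<in> Poly_Mapping.keys (P * frag_of [b] - frag_of (w @ [b]))
      \<or> u \<in> Poly_Mapping.keys (frag_of [b] * P)"
    using u unfolding eq by (rule keys_diff_cmul)
  then show "length u = length (w @ [b]) \<and> w @ [b] < u"
  proof
    assume "u \<in> Poly_Mapping.keys (P * frag_of [b] - frag_of (w @ [b]))"
    then show ?thesis
      using has_lead_times[OF w(1), of "[b]" "frag_of [b]"] unfolding has_lead_def by simp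
  next
    assume "u \<in> Poly_Mapping.keys (frag_of [b] * P)"
    then obtain v where "v \<in> Poly_Mapping.keys P" "u = b # v"
      by (elim keys_times) auto
    then show ?thesis
      using has_lead_keys[OF w(1), of v] w(2,3) by (cases w) auto
  qed
qed

lemma has_lead_foldl_bracket:
  assumes "has_lead w P" "w \<noteq> []" "\<forall>b\<in>set v. hd w < b"
  shows "has_lead (w @ v) (foldl bracket P (map (\<lambda>b. frag_of [b]) v))"
  using assms
proof (induction v arbitrary: w P)
  case (Cons b v)
  then show ?case
    using Cons.IH[of "w @ [b]" "bracket P (frag_of [b])"] has_lead_bracket_letter[of w P b] by simp
qed simp

lemma has_lead_left_normed: "lie_word w \<Longrightarrow> has_lead w (left_normed w)"
  by (cases w) (use has_lead_foldl_bracket[of "[hd w]" "frag_of [hd w]" "tl w"] in auto)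

text \<open>In a relation, take the vector with the smallest leading word among those with nonzero
  coefficient: no other vector contributes at that word.\<close>

lemma independent_if_has_lead:
  assumes ex: "\<And>x. x \<in> X \<Longrightarrow> \<exists>w. has_lead w x"
    and uniq: "\<And>x y w. x \<in> X \<Longrightarrow> y \<in> X \<Longrightarrow> has_lead w x \<Longrightarrow> has_lead w y \<Longrightarrow> x = y"
  shows "frag.independent X"
proof
  assume "frag.dependent X"
  then obtain t u v where t: "finite t" "t \<subseteq> X" "(\<Sum>v\<in>t. frag_cmul (u v) v) = 0"
    and v: "v \<in> t" "u v \<noteq> 0"
    unfolding frag.dependent_explicit by blast
  obtain ld where ld: "\<And>x. x \<in> X \<Longrightarrow> has_lead (ld x) x" using ex by metis
  define t' where "t' = {v \<in> t. u v \<noteq> 0}"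
  have "finite t'" "t' \<noteq> {}" using t v by (auto simp: t'_def)
  then have "Min (ld ` t') \<in> ld ` t'" by simp
  then obtain x where x: "x \<in> t'" "ld x = Min (ld ` t')" by auto
  have "u y * poly_mapping.lookup y (ld x) = 0" if y: "y \<in> t" "y \<noteq> x" for y
  proof (cases "u y = 0")
    case False
    have "ld x \<le> ld y" using False y \<open>finite t'\<close> x by (simp add: t'_def)
    moreover have "ld x \<noteq> ld y"
    proof
      have "x \<in> X" "y \<in> X" using x y t by (auto simp: t'_def)
      moreover assume "ld x = ld y"
      ultimately show False using uniq[of x y "ld x"] ld[of x] ld[of y] y(2) by simp
    qed
    moreover have "has_lead (ld y) y" using ld y t by blast
    ultimately show ?thesis using has_lead_lookup_less[of "ld y" y "ld x"] by simp
  qed simp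
  then have "poly_mapping.lookup (\<Sum>v\<in>t. frag_cmul (u v) v) (ld x)
      = (\<Sum>y\<in>t. if y = x then u x * poly_mapping.lookup x (ld x) else 0)"
    unfolding lookup_sum by (intro sum.cong) auto
  also have "\<dots> = u x" using t x has_lead_lookup[OF ld, of x] by (auto simp: t'_def)
  finally show False using t x by (simp add: t'_def)
qed

text \<open>Division with remainder: subtracting a multiple of a suitable \<open>x\<close> removes
  the least word of \<open>z\<close>. Since \<open>x\<close> has leading coefficient 1, the
  multiplier is an integer.\<close>

lemma span_if_has_lead:
  assumes X: "X \<subseteq> M" and M: "frag.span M = M"
    and V: "finite V" "\<And>z. z \<in> M \<Longrightarrow> Poly_Mapping.keys z \<subseteq> V"
    and ex: "\<And>z. z \<in> M \<Longrightarrow> z \<noteq> 0 \<Longrightarrow> \<exists>x\<in>X. has_lead (Min (Poly_Mapping.keys z)) x"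
  shows "frag.span X = M"
proof
  show "frag.span X \<subseteq> M" using frag.span_mono[OF X] M by simp
  \<comment> \<open>The words of \<open>V\<close> at or above the least key of \<open>z\<close>.
    Unlike \<open>Min\<close>, this set also makes sense for \<open>z = 0\<close>, and it shrinks at
    each subtraction.\<close>
  let ?U = "\<lambda>z. {w \<in> V. \<exists>u\<in>Poly_Mapping.keys z. u \<le> w}"
  have "z \<in> frag.span X" if "z \<in> M" for z
    using that
  proof (induction "card (?U z)" arbitrary: z rule: less_induct)
    case less
    show ?case
    proof (cases "z = 0")
      case False
      define w where "w = Min (Poly_Mapping.keys z)"
      have w: "w \<in> Poly_Mapping.keys z" using False by (simp add: w_def)
      obtain x where x: "x \<in> X" "has_lead w x"
        using ex[OF less.prems False] by (auto simp: w_def)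
      define z' where "z' = z - frag_cmul (poly_mapping.lookup z w) x"
      have "frag_cmul (poly_mapping.lookup z w) x \<in> M"
        using x X M by (metis frag.span_base frag.span_scale subsetD)
      then have z': "z' \<in> M"
        using less.prems M unfolding z'_def by (metis frag.span_diff)
      have gt: "w < u" if "u \<in> Poly_Mapping.keys z'" for u
      proof -
        have "u \<noteq> w"
          using that has_lead_lookup[OF x(2)] by (auto simp: z'_def in_keys_iff lookup_minus)
        moreover have "u \<in> Poly_Mapping.keys z \<or> u \<in> Poly_Mapping.keys x"
          using that unfolding z'_def by (rule keys_diff_cmul)
        then have "w \<le> u"
        proof
          assume "u \<in> Poly_Mapping.keys x"
          then show ?thesis using has_lead_keys[OF x(2), of u] by auto
        qed (simp add: w_def)
        ultimately show ?thesis by simp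
      qed
      have "?U z' \<subseteq> ?U z"
      proof
        fix v assume "v \<in> ?U z'"
        then obtain u where "v \<in> V" "u \<in> Poly_Mapping.keys z'" "u \<le> v" by blast
        then have "w \<le> v" using gt[of u] by simp
        with w \<open>v \<in> V\<close> show "v \<in> ?U z" by blast
      qed
      moreover have "w \<in> ?U z" using w V(2)[OF less.prems] by blast
      moreover have "w \<notin> ?U z'" using gt by (auto simp flip: not_less)
      ultimately have "?U z' \<subset> ?U z" by blast
      then have "card (?U z') < card (?U z)" using V(1) by (intro psubset_card_mono) auto
      then have "z' \<in> frag.span X" using less.hyps z' by blast
      moreover have "z = z' + frag_cmul (poly_mapping.lookup z w) x" by (simp add: z'_def)
      ultimately show ?thesis
        using x(1) by (metis frag.span_add frag.span_base frag.span_scale)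
    qed (simp add: frag.span_zero)
  qed
  then show "M \<subseteq> frag.span X" by blast
qed


section \<open>Cutting a word at its left-to-right minima\<close>

text \<open>Indexes all products of basis brackets over ordered partitions of \<open>A\<close>, with
  the factors in any order; distinctness of the concatenation makes the blocks disjoint.\<close>

definition block_words :: "nat set \<Rightarrow> nat list list set" where
  "block_words A = {ws. (\<forall>w\<in>set ws. lie_word w) \<and> distinct (concat ws) \<and> set (concat ws) = A}"

definition lie_prod :: "nat list list \<Rightarrow> ncpoly" where
  "lie_prod ws = prod_list (map left_normed ws)"

lemma has_lead_lie_prod: "\<forall>w\<in>set ws. lie_word w \<Longrightarrow> has_lead (concat ws) (lie_prod ws)"
  unfolding lie_prod_def
proof (induction ws)
  case Nil
  then show ?case using has_lead_frag_of[of "[]"] by (simp add: frag_of_Nil)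
qed (simp add: has_lead_left_normed has_lead_times)

lemma keys_lie_prod: "u \<in> Poly_Mapping.keys (lie_prod ws) \<Longrightarrow> mset u = mset (concat ws)"
  unfolding lie_prod_def
proof (induction ws arbitrary: u)
  case Nil
  then show ?case by (simp flip: frag_of_Nil)
next
  case (Cons w ws)
  then obtain a b where "a \<in> Poly_Mapping.keys (left_normed w)"
    "b \<in> Poly_Mapping.keys (prod_list (map left_normed ws))" "u = a @ b"
    by (auto elim: keys_times)
  then show ?case using Cons.IH keys_left_normed by simp
qed

lemma lie_word_hd_le:
  assumes "lie_word w" "b \<in> set w"
  shows "hd w \<le> b"
proof (cases w)
  case (Cons a v)
  with assms show ?thesis by auto
qed (use assms in simp)

text \<open>The smallest letter of the word starts the last block; the prefix before it is cut
  recursively.\<close>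

lemma ex_decreasing_factorization:
  assumes "distinct w"
  obtains ws where "concat ws = w" "sorted_wrt (\<lambda>u v. hd v < hd u) ws"
    "\<forall>v\<in>set ws. v = [hd v] \<or> lie_word v"
proof -
  have "\<exists>ws. concat ws = w \<and> sorted_wrt (\<lambda>u v. hd v < hd u) ws
      \<and> (\<forall>v\<in>set ws. v = [hd v] \<or> lie_word v)"
    using assms
  proof (induction w rule: length_induct)
    case (1 w)
    show ?case
    proof (cases "w = []")
      case True
      then show ?thesis by (intro exI[of _ "[]"]) simp
    next
      case False
      define m where "m = Min (set w)"
      have "m \<in> set w" using False by (simp add: m_def)
      then obtain u v where w: "w = u @ m # v" by (meson split_list)
      have less: "m < y" if "y \<in> set u \<union> set v" for y
      proof -
        have "y \<in> set w" using that by (auto simp: w)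
        then have "m \<le> y" by (simp add: m_def)
        moreover have "m \<noteq> y" using that 1(2) by (auto simp: w)
        ultimately show ?thesis by simp
      qed
      have "length u < length w" "distinct u" using 1(2) by (simp_all add: w)
      from 1(1)[rule_format, OF this]
      obtain ws where ws: "concat ws = u" "sorted_wrt (\<lambda>u v. hd v < hd u) ws"
        "\<forall>v\<in>set ws. v = [hd v] \<or> lie_word v" by (elim exE conjE)
      have "m < hd x" if "x \<in> set ws" for x
      proof -
        have "x \<noteq> []" using ws(3) that by auto
        then have "hd x \<in> set x" by (rule hd_in_set)
        then have "hd x \<in> set u" using that unfolding ws(1)[symmetric] set_concat by blast
        then show ?thesis using less by blast
      qed
      \<comment> \<open>A one-letter block arises exactly when the minimum is the last
        letter.\<close>
      moreover have "v = [] \<or> lie_word (m # v)"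
        using less 1(2) by (auto simp: w)
      ultimately have "sorted_wrt (\<lambda>u v. hd v < hd u) (ws @ [m # v])"
        "\<forall>x\<in>set (ws @ [m # v]). x = [hd x] \<or> lie_word x"
        using ws(2,3) by (auto simp: sorted_wrt_append)
      moreover have "concat (ws @ [m # v]) = w" using ws(1) w by simp
      ultimately show ?thesis by blast
    qed
  qed
  then show thesis using that by blast
qed

text \<open>In any such factorization the last block starts at the smallest letter of the whole
  word, so the last cut is forced.\<close>

lemma decreasing_factorization_unique:
  assumes "\<forall>w\<in>set ws. lie_word w" "\<forall>w\<in>set vs. lie_word w"
    and "sorted_wrt (\<lambda>u v. hd v < hd u) ws" "sorted_wrt (\<lambda>u v. hd v < hd u) vs"
    and "distinct (concat ws)" "concat ws = concat vs"
  shows "ws = vs"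
  using assms
proof (induction ws arbitrary: vs rule: rev_induct)
  case Nil
  then show ?case by (cases vs) auto
next
  case (snoc w ws)
  have "vs \<noteq> []" using snoc.prems by (cases w) auto
  then obtain us v where vs: "vs = us @ [v]" by (metis rev_exhaust)
  have last_min: "hd b < y" if "sorted_wrt (\<lambda>u v. hd v < hd u) (as @ [b])"
    "\<forall>w\<in>set (as @ [b]). lie_word w" "y \<in> set (concat as)" for as b and y :: nat
  proof -
    obtain a where a: "a \<in> set as" "y \<in> set a" using \<open>y \<in> set (concat as)\<close> by auto
    then have "hd b < hd a" "lie_word a" using that(1,2) by (auto simp: sorted_wrt_append)
    with lie_word_hd_le a(2) show ?thesis by (meson less_le_trans)
  qed
  obtain m x where w: "w = m # x" "\<forall>b\<in>set x. m < b" using snoc.prems(1) by (cases w) auto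
  obtain n y where v: "v = n # y" "\<forall>b\<in>set y. n < b" using snoc.prems(2) vs by (cases v) auto
  have m: "\<forall>b\<in>set (concat ws). m < b" using last_min[OF snoc.prems(3,1)] w by simp
  have n: "\<forall>b\<in>set (concat us). n < b"
    using last_min[OF snoc.prems(4,2)[unfolded vs]] v by simp
  have eq: "concat ws @ m # x = concat us @ n # y" using snoc.prems(6) by (simp add: w v vs)
  have "m \<in> set (concat us @ n # y)" "n \<in> set (concat ws @ m # x)"
    using eq by (metis in_set_conv_decomp)+
  then have "m = n" using w(2) v(2) m n by (fastforce dest: less_asym)
  then have "concat ws = concat us" "x = y"
    using eq m n w v by (metis append_Cons_eq_iff less_irrefl)+
  moreover have "ws = us"
    by (rule snoc.IH) (use snoc.prems vs calculation in \<open>auto simp: sorted_wrt_append\<close>)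
  ultimately show ?case using w v vs \<open>m = n\<close> by simp
qed


section \<open>Products of left-normed brackets are Lie products\<close>

lemma distinct_lie_word: "lie_word w \<Longrightarrow> distinct w"
  by (cases w) auto

lemma length_lie_word: "lie_word w \<Longrightarrow> 2 \<le> length w"
proof (cases w)
  case (Cons a v)
  then show "lie_word w \<Longrightarrow> ?thesis" by (cases v) auto
qed simp

lemma foldl_bracket_lie_poly:
  assumes "P \<in> lie_polys k" "set w \<subseteq> {1..k}"
  shows "foldl bracket P (map (\<lambda>b. frag_of [b]) w) \<in> lie_polys k"
  using assms by (induction w arbitrary: P) (simp_all add: lie_polys.bracket lie_polys.letter)

lemma left_normed_inj_lie:
  assumes "lie_word w" "set w \<subseteq> {1..k}"
  shows "left_normed w \<in> inj_lie k (set w)"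
proof -
  have "left_normed w \<in> lie_polys k"
  proof (cases w)
    case (Cons a v)
    then show ?thesis
      using foldl_bracket_lie_poly[of "frag_of [a]" k v] assms(2) by (simp add: lie_polys.letter)
  qed (use assms in simp)
  moreover have "card (set w) = length w"
    using assms(1) by (simp add: distinct_lie_word distinct_card)
  moreover have "length u = length w \<and> distinct u \<and> set u \<subseteq> set w"
    if "u \<in> Poly_Mapping.keys (left_normed w)" for u
    using keys_left_normed[OF that] distinct_lie_word[OF assms(1)]
    by (metis mset_eq_imp_distinct_iff mset_eq_length mset_eq_setD order_refl)
  ultimately show ?thesis
    using length_lie_word[OF assms(1)] by (simp add: inj_lie_def)
qed

lemma inj_words_top: "w \<in> inj_words k (int k - 1) \<longleftrightarrow> distinct w \<and> set w = {1..k}"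
proof
  assume "w \<in> inj_words k (int k - 1)"
  then have "distinct w" "set w \<subseteq> {1..k}" "card (set w) = card {1..k}"
    by (auto simp: inj_words_def distinct_card)
  then show "distinct w \<and> set w = {1..k}" by (simp add: card_subset_eq)
next
  assume "distinct w \<and> set w = {1..k}"
  then show "w \<in> inj_words k (int k - 1)"
    using distinct_card[of w] by (simp add: inj_words_def)
qed

lemma ordered_partition_map_set:
  assumes "\<forall>w\<in>set ws. lie_word w"
  shows "ordered_partition A (map set ws) \<longleftrightarrow> distinct (concat ws) \<and> set (concat ws) = A"
proof -
  have ne: "w \<noteq> []" "distinct w" if "w \<in> set ws" for w
    using assms that distinct_lie_word by auto
  \<comment> \<open>\<open>distinct_concat_iff\<close> speaks of the list with empty words
    removed.\<close>
  then have "removeAll [] ws = ws" by (metis removeAll_id)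
  show ?thesis
  proof
    assume *: "ordered_partition A (map set ws)"
    then have "distinct ws" "inj_on set (set ws)"
      by (simp_all add: ordered_partition_def distinct_map)
    moreover have "set u \<inter> set v = {}" if "u \<in> set ws" "v \<in> set ws" "u \<noteq> v" for u v
    proof -
      have "set u \<noteq> set v" using \<open>inj_on set (set ws)\<close> that by (meson inj_onD)
      then show ?thesis
        using * that by (auto simp: ordered_partition_def partition_on_def disjoint_def)
    qed
    ultimately show "distinct (concat ws) \<and> set (concat ws) = A"
      using * ne by (auto simp: distinct_concat ordered_partition_def partition_on_def)
  next
    assume *: "distinct (concat ws) \<and> set (concat ws) = A"
    then have dj: "set u \<inter> set v = {}" if "u \<in> set ws" "v \<in> set ws" "u \<noteq> v" for u v
      using that unfolding distinct_concat_iff by blast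
    have "distinct ws"
      using * \<open>removeAll [] ws = ws\<close> by (simp add: distinct_concat_iff)
    moreover have "inj_on set (set ws)"
    proof (rule inj_onI)
      fix u v assume uv: "u \<in> set ws" "v \<in> set ws" "set u = set v"
      then show "u = v" using dj[of u v] ne(1)[of u] by fastforce
    qed
    ultimately have "distinct (map set ws)" by (simp add: distinct_map)
    moreover have "partition_on A (set (map set ws))"
      using * ne(1) dj by (auto simp: partition_on_def disjoint_def)
    ultimately show "ordered_partition A (map set ws)" by (simp add: ordered_partition_def)
  qed
qed

lemma lie_prod_in_lie_products:
  assumes "ws \<in> block_words {1..k}"
  shows "lie_prod ws \<in> lie_products k"
proof -
  have ws: "\<forall>w\<in>set ws. lie_word w" "distinct (concat ws)" "set (concat ws) = {1..k}"
    using assms by (simp_all add: block_words_def)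
  have "lie_prod ws \<in> carrier (chain_gp k (int k - 1))"
  proof -
    have "u \<in> inj_words k (int k - 1)" if "u \<in> Poly_Mapping.keys (lie_prod ws)" for u
      using mset_eq_imp_distinct_iff[OF keys_lie_prod[OF that]]
        mset_eq_setD[OF keys_lie_prod[OF that]] ws(2,3) by (simp only: inj_words_top simp_thms)
    then show ?thesis by auto
  qed
  moreover have "list_all2 (\<lambda>Q S. Q \<in> inj_lie k S) (map left_normed ws) (map set ws)"
  proof -
    have "left_normed w \<in> inj_lie k (set w)" if "w \<in> set ws" for w
      using that ws(1,3) by (intro left_normed_inj_lie) auto
    then show ?thesis by (simp add: list_all2_map1 list_all2_map2 list_all2_same)
  qed
  moreover have "ordered_partition {1..k} (map set ws)"
    using ws by (simp add: ordered_partition_map_set)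
  ultimately show ?thesis unfolding lie_products_def lie_prod_def by blast
qed


section \<open>The basis with decreasing smallest letters\<close>

text \<open>If \<open>w = p @ x # q\<close> had a one-letter block \<open>x\<close>, then moving \<open>x\<close> elsewhere would make \<open>w\<close>
  smaller, so the coefficient of \<open>p @ q\<close> in \<open>boundary z\<close> would be that of \<open>w\<close> in \<open>z\<close>, up to sign.\<close>

lemma least_word_no_singleton_block:
  assumes z: "z \<in> top_cycles k" "z \<noteq> 0" and w: "Min (Poly_Mapping.keys z) = p @ x # q"
    and p: "\<forall>y\<in>set p. x < y" and q: "q \<noteq> [] \<longrightarrow> hd q < x"
  shows False
proof -
  let ?w = "p @ x # q"
  have keys: "u \<in> inj_words k (int k - 1)" if "u \<in> Poly_Mapping.keys z" for u
    using z(1) that by (auto simp: top_cycles_def cycles_def)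
  have wz: "?w \<in> Poly_Mapping.keys z" unfolding w[symmetric] using z(2) by simp
  have *: "u = ?w \<and> j = length p"
    if u: "u \<in> Poly_Mapping.keys z" and j: "j < length u" and face: "face j u = p @ q" for u j
  proof -
    define a b where "a = take j u" and "b = drop (Suc j) u"
    have ujb: "u = a @ u ! j # b" unfolding a_def b_def using j by (rule id_take_nth_drop)
    have ab: "a @ b = p @ q" using face by (simp add: a_def b_def face_def)
    have "set u = set ?w" "distinct u" "distinct ?w"
      using keys[OF u] keys[OF wz] by (simp_all add: inj_words_top)
    moreover from this have "u ! j \<notin> set (a @ b)"
      by (metis ujb not_distinct_conv_prefix set_append Un_iff distinct_append
          distinct.simps(2) disjoint_iff list.set_intros(1))
    moreover have "set u = insert (u ! j) (set (a @ b))"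
      using arg_cong[OF ujb, of set] by simp
    \<comment> \<open>\<open>u\<close> and \<open>?w\<close> use the same letters, so the letter
      deleted from \<open>u\<close> is the one missing from \<open>p @ q\<close>.\<close>
    ultimately have "u ! j = x" unfolding ab by auto
    with ujb have ux: "u = a @ x # b" by simp
    have "?w \<le> u" using u by (simp flip: w)
    \<comment> \<open>\<open>c\<close> is the stretch that \<open>x\<close> jumps over. Moving
      right, the smaller letter \<open>hd q\<close> takes the place of \<open>x\<close>; moving
      left, \<open>x\<close> takes the place of a larger letter of \<open>p\<close>. Both would give
      a word below the minimum \<open>?w\<close>.\<close>
    from ab obtain c where "a = p @ c \<and> c @ b = q \<or> a @ c = p \<and> b = c @ q"
      unfolding append_eq_append_conv2 by blast
    then have "c = []"
    proof (elim disjE conjE)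
      assume c: "a = p @ c" "c @ b = q"
      show "c = []"
      proof (cases c)
        case (Cons y c')
        have "u < ?w" using c q Cons by (auto simp: ux append_less_append_iff)
        with \<open>?w \<le> u\<close> show ?thesis by simp
      qed
    next
      assume c: "a @ c = p" "b = c @ q"
      show "c = []"
      proof (cases c)
        case (Cons y c')
        have "u < ?w" using c p Cons by (auto simp: ux append_less_append_iff)
        with \<open>?w \<le> u\<close> show ?thesis by simp
      qed
    qed
    with \<open>a = p @ c \<and> c @ b = q \<or> a @ c = p \<and> b = c @ q\<close> have "a = p" "b = q" by auto
    moreover have "length a = j" using j by (simp add: a_def)
    ultimately show ?thesis using ux by blast
  qed
  have "poly_mapping.lookup (boundary z) (p @ q)
      = (\<Sum>u\<in>Poly_Mapping.keys z. poly_mapping.lookup z u *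
          (\<Sum>j<length u. (-1) ^ j * (if face j u = p @ q then 1 else 0)))"
    by (simp add: boundary_def frag_extend_def lookup_sum eq_commute)
  also have "\<dots> = (\<Sum>u\<in>Poly_Mapping.keys z. if u = ?w
      then poly_mapping.lookup z ?w * (-1) ^ length p else 0)"
  proof (rule sum.cong[OF refl])
    fix u assume u: "u \<in> Poly_Mapping.keys z"
    have face: "face (length p) ?w = p @ q" by (simp add: face_def)
    have "(\<Sum>j<length u. (-1) ^ j * (if face j u = p @ q then 1 else 0))
      = (\<Sum>j<length u. if j = length p then if u = ?w then (-1) ^ length p else 0 else (0::int))"
    proof (rule sum.cong[OF refl])
      fix j assume "j \<in> {..<length u}"
      then have "face j u = p @ q \<longleftrightarrow> j = length p \<and> u = ?w"
        using *[OF u, of j] face by blast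
      then show "(-1) ^ j * (if face j u = p @ q then 1 else 0)
        = (if j = length p then if u = ?w then (-1) ^ length p else 0 else (0::int))" by simp
    qed
    also have "\<dots> = (if u = ?w then (-1) ^ length p else 0)" by simp
    finally show "poly_mapping.lookup z u
        * (\<Sum>j<length u. (-1) ^ j * (if face j u = p @ q then 1 else 0))
      = (if u = ?w then poly_mapping.lookup z ?w * (-1) ^ length p else 0)" by simp
  qed
  also have "\<dots> = poly_mapping.lookup z ?w * (-1) ^ length p" using wz by simp
  also have "\<dots> \<noteq> 0" using wz by (simp add: in_keys_iff)
  finally show False using z(1) by (simp add: top_cycles_def cycles_def)
qed

text \<open>Integer keys allow decreasing smallest letters (by negation) and ranks in a given order
  to be treated alike.\<close>

definition sorted_prods :: "nat set \<Rightarrow> (nat list \<Rightarrow> int) \<Rightarrow> ncpoly set" where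
  "sorted_prods A key = lie_prod ` {ws \<in> block_words A. sorted_wrt (\<lambda>u v. key u < key v) ws}"

text \<open>\<open>is_Z_basis\<close> concerns sets, while the change of basis works with indexed
  families; the leading word recovers the index.\<close>

lemma inj_on_lie_prod_decreasing:
  "inj_on lie_prod {ws \<in> block_words A. sorted_wrt (\<lambda>u v. - int (hd u) < - int (hd v)) ws}"
proof (rule inj_onI)
  fix us vs
  assume us: "us \<in> {ws \<in> block_words A. sorted_wrt (\<lambda>u v. - int (hd u) < - int (hd v)) ws}"
    and vs: "vs \<in> {ws \<in> block_words A. sorted_wrt (\<lambda>u v. - int (hd u) < - int (hd v)) ws}"
    and "lie_prod us = lie_prod vs"
  then have "concat us = concat vs"
    using has_lead_lie_prod[of us] has_lead_lie_prod[of vs]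
    by (auto simp: block_words_def intro: has_lead_unique)
  then show "us = vs"
    using us vs by (intro decreasing_factorization_unique) (auto simp: block_words_def)
qed

lemma decreasing_basis:
  "is_Z_basis (sorted_prods {1..k} (\<lambda>w. - int (hd w))) (top_cycles k)"
  (is "is_Z_basis ?X _")
proof -
  let ?I = "{ws \<in> block_words {1..k}. sorted_wrt (\<lambda>u v. - int (hd u) < - int (hd v)) ws}"
  have lead: "has_lead (concat ws) (lie_prod ws)" if "ws \<in> ?I" for ws
    using that by (auto simp: block_words_def intro: has_lead_lie_prod)
  have "frag.independent ?X"
  proof (rule independent_if_has_lead)
    show "\<exists>w. has_lead w x" if "x \<in> ?X" for x
      using that lead by (auto simp: sorted_prods_def)
    fix x y w
    assume "x \<in> ?X" "y \<in> ?X" and w: "has_lead w x" "has_lead w y"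
    then obtain us vs where us: "us \<in> ?I" "x = lie_prod us" and vs: "vs \<in> ?I" "y = lie_prod vs"
      unfolding sorted_prods_def by blast
    have "concat us = w" "concat vs = w"
      using has_lead_unique lead us vs w by blast+
    then have "us = vs"
      using us vs by (intro decreasing_factorization_unique) (auto simp: block_words_def)
    then show "x = y" using us vs by simp
  qed
  moreover have "frag.span ?X = top_cycles k"
  proof (rule span_if_has_lead[OF _ span_top_cycles])
    show "?X \<subseteq> top_cycles k"
      using lie_prod_in_lie_products lie_products_subset_cycles by (auto simp: sorted_prods_def)
    show "finite (inj_words k (int k - 1))"
      by (rule finite_subset[OF _ finite_subset_distinct[of "{1..k}"]]) (auto simp: inj_words_def)
    show "Poly_Mapping.keys z \<subseteq> inj_words k (int k - 1)" if "z \<in> top_cycles k" for z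
      using that by (simp add: top_cycles_def cycles_def)
    show "\<exists>x\<in>?X. has_lead (Min (Poly_Mapping.keys z)) x"
      if z: "z \<in> top_cycles k" "z \<noteq> 0" for z
    proof -
      define w where "w = Min (Poly_Mapping.keys z)"
      have "w \<in> Poly_Mapping.keys z" using z(2) by (simp add: w_def)
      then have w: "distinct w" "set w = {1..k}"
        using z(1) by (auto simp: top_cycles_def cycles_def inj_words_top)
      obtain ws where ws: "concat ws = w" "sorted_wrt (\<lambda>u v. hd v < hd u) ws"
        "\<forall>v\<in>set ws. v = [hd v] \<or> lie_word v"
        using ex_decreasing_factorization[OF w(1)] .
      have "lie_word v" if v: "v \<in> set ws" for v
      proof (rule ccontr)
        assume "\<not> lie_word v"
        then obtain x where x: "v = [x]" using bspec[OF ws(3) v] by blast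
        obtain us vs where usvs: "ws = us @ [x] # vs" using v x by (meson split_list)
        have hd: "hd u \<le> y \<and> u \<noteq> []" if "u \<in> set ws" "y \<in> set u" for u y
        proof -
          from bspec[OF ws(3) that(1)] show ?thesis
          proof
            assume "u = [hd u]"
            then show ?thesis using that(2) by (metis empty_iff empty_set order_refl set_ConsD)
          next
            assume "lie_word u"
            then show ?thesis using lie_word_hd_le that(2) by auto
          qed
        qed
        \<comment> \<open>Heads decrease along \<open>ws\<close>, so \<open>x\<close> is below all
          earlier letters and the next block starts below \<open>x\<close>.\<close>
        show False
        proof (rule least_word_no_singleton_block[OF z])
          show "Min (Poly_Mapping.keys z) = concat us @ x # concat vs"
            using ws(1) by (simp add: w_def usvs)
          show "\<forall>y\<in>set (concat us). x < y"
          proof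
            fix y assume "y \<in> set (concat us)"
            then obtain u where u: "u \<in> set us" "y \<in> set u" by auto
            then have "x < hd u" using ws(2) by (simp add: usvs sorted_wrt_append)
            then show "x < y" using hd[of u y] u by (simp add: usvs)
          qed
          show "concat vs \<noteq> [] \<longrightarrow> hd (concat vs) < x"
          proof (cases vs)
            case (Cons v' vs')
            have "v' \<noteq> []" using ws(3) by (auto simp: usvs Cons)
            moreover have "hd v' < x" using ws(2) by (simp add: usvs Cons sorted_wrt_append)
            ultimately show ?thesis by (simp add: Cons)
          qed simp
        qed
      qed
      then have "ws \<in> ?I" using ws(1,2) w by (auto simp: block_words_def simp del: set_concat)
      then have "has_lead w (lie_prod ws)" "lie_prod ws \<in> ?X"
        using lead[of ws] ws(1) by (auto simp: sorted_prods_def)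
      then show ?thesis unfolding w_def by blast
    qed
  qed
  ultimately show ?thesis by (simp add: is_Z_basis_def)
qed


section \<open>Reordering the factors\<close>

text \<open>Congruence modulo \<open>V\<close> up to sign: the signs of graded swaps are forgotten,
  as a diagonal of 1 and -1 is invertible over the integers.\<close>

definition cong_sign :: "ncpoly set \<Rightarrow> ncpoly \<Rightarrow> ncpoly \<Rightarrow> bool" where
  "cong_sign V x y \<longleftrightarrow> x - y \<in> V \<or> x + y \<in> V"

lemma cong_sign_refl: "cong_sign (frag.span V) x x"
  by (simp add: cong_sign_def frag.span_zero)

lemma cong_sign_trans:
  assumes "cong_sign (frag.span V) x y" "cong_sign (frag.span V) y z"
  shows "cong_sign (frag.span V) x z"
proof -
  have "x - z = (x - y) + (y - z)" "x + z = (x - y) + (y + z)"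
    "x + z = (x + y) - (y - z)" "x - z = (x + y) - (y + z)" by simp_all
  then show ?thesis
    using assms unfolding cong_sign_def by (metis frag.span_add frag.span_diff)
qed

lemma cong_sign_mono: "cong_sign V x y \<Longrightarrow> V \<subseteq> W \<Longrightarrow> cong_sign W x y"
  by (auto simp: cong_sign_def)

lemma cong_sign_span_iff:
  assumes "cong_sign (frag.span V) x y" "V \<subseteq> frag.span W"
  shows "x \<in> frag.span W \<longleftrightarrow> y \<in> frag.span W"
proof -
  have V: "frag.span V \<subseteq> frag.span W" using assms(2) by (rule frag.span_minimal) simp
  consider "x - y \<in> frag.span W" | "x + y \<in> frag.span W"
    using assms(1) V unfolding cong_sign_def by blast
  then show ?thesis
  proof cases
    case 1
    show ?thesis using frag.span_add[OF 1, of y] frag.span_diff[OF _ 1, of x] by auto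
  next
    case 2
    show ?thesis using frag.span_diff[OF 2, of x] frag.span_diff[OF 2, of y] by auto
  qed
qed

text \<open>The filtration by number of factors, spanned by products in every order.\<close>

definition low :: "nat set \<Rightarrow> nat \<Rightarrow> ncpoly set" where
  "low A m = frag.span (lie_prod ` {ws \<in> block_words A. length ws < m})"

lemma lie_prod_Cons: "lie_prod (w # ws) = left_normed w * lie_prod ws"
  by (simp add: lie_prod_def)

lemma block_words_Cons:
  "w # ws \<in> block_words A \<longleftrightarrow> lie_word w \<and> set w \<subseteq> A \<and> ws \<in> block_words (A - set w)"
  using distinct_lie_word[of w] by (auto simp: block_words_def)

lemma block_words_mset:
  assumes "mset ws = mset vs"
  shows "ws \<in> block_words A \<longleftrightarrow> vs \<in> block_words A"
proof -
  have "mset (concat us) = \<Sum>\<^sub># (image_mset mset (mset us))" for us :: "nat list list"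
    by (induction us) auto
  then have "mset (concat ws) = mset (concat vs)" using assms by simp
  then show ?thesis
    using mset_eq_setD[OF assms] mset_eq_setD[of "concat ws" "concat vs"]
      mset_eq_imp_distinct_iff[of "concat ws" "concat vs"]
    by (simp add: block_words_def del: set_concat)
qed

lemma left_normed_times_low:
  assumes "lie_word w" "set w \<subseteq> A" "x \<in> low (A - set w) m"
  shows "left_normed w * x \<in> low A (Suc m)"
proof -
  have "left_normed w * lie_prod ws \<in> low A (Suc m)"
    if "ws \<in> block_words (A - set w)" "length ws < m" for ws
  proof -
    have "w # ws \<in> {ws \<in> block_words A. length ws < Suc m}"
      using that assms(1,2) by (simp add: block_words_Cons)
    then have "lie_prod (w # ws) \<in> low A (Suc m)"
      unfolding low_def by (intro frag.span_base imageI)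
    then show ?thesis by (simp add: lie_prod_Cons)
  qed
  then show ?thesis
    using assms(3) unfolding low_def
    by (intro linear_image_span[of "(*) (left_normed w)" _ _ x])
      (auto simp: distrib_left frag_cmul_times_right)
qed

text \<open>Prefixing a factor raises the filtration level and the number of factors alike by one,
  so error terms stay of lower order.\<close>

lemma cong_sign_left_normed_times:
  assumes "lie_word w" "set w \<subseteq> A" "cong_sign (low (A - set w) m) x y"
  shows "cong_sign (low A (Suc m)) (left_normed w * x) (left_normed w * y)"
  using left_normed_times_low[OF assms(1,2)] assms(3)
  unfolding cong_sign_def by (metis distrib_left right_diff_distrib)

text \<open>\<open>bracket_lie_words\<close> expands the bracket of the two factors into basis
  brackets on the union of their letters.\<close>

lemma lie_prod_swap:
  assumes "u # v # ws \<in> block_words A"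
  shows "cong_sign (low A (length (u # v # ws))) (lie_prod (u # v # ws)) (lie_prod (v # u # ws))"
proof -
  have uv: "lie_word u" "lie_word v" "set u \<inter> set v = {}" and A: "set u \<subseteq> A" "set v \<subseteq> A"
    and ws: "ws \<in> block_words (A - (set u \<union> set v))"
    using assms by (auto simp: block_words_Cons Diff_Diff_Int Diff_eq Int_assoc)
  have "left_normed t * lie_prod ws \<in> low A (length (u # v # ws))"
    if "lie_word t" "set t = set u \<union> set v" for t
  proof -
    have "t # ws \<in> {ts \<in> block_words A. length ts < length (u # v # ws)}"
      using that A ws by (simp add: block_words_Cons)
    then have "lie_prod (t # ws) \<in> low A (length (u # v # ws))"
      unfolding low_def by (intro frag.span_base imageI)
    then show ?thesis by (simp add: lie_prod_Cons)
  qed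
  then have "bracket (left_normed u) (left_normed v) * lie_prod ws \<in> low A (length (u # v # ws))"
    unfolding low_def
    by (intro linear_image_span[of "\<lambda>x. x * lie_prod ws", OF _ _ _ bracket_lie_words[OF uv]])
      (auto simp: distrib_right frag_cmul_times_left)
  then show ?thesis
    unfolding cong_sign_def bracket_eq[OF homogeneous_left_normed homogeneous_left_normed]
    by (cases "even (length u)"; cases "even (length v)")
      (simp_all add: lie_prod_Cons algebra_simps)
qed

lemma lie_prod_move_to_front:
  assumes "us @ v # ws \<in> block_words A"
  shows "cong_sign (low A (length (us @ v # ws))) (lie_prod (us @ v # ws)) (lie_prod (v # us @ ws))"
  using assms
proof (induction us arbitrary: A)
  case Nil
  then show ?case by (simp add: low_def cong_sign_refl)
next
  case (Cons u us)
  have "u # v # us @ ws \<in> block_words A"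
    using Cons.prems block_words_mset[of "(u # us) @ v # ws" "u # v # us @ ws"] by simp
  from lie_prod_swap[OF this]
  have "cong_sign (low A (length ((u # us) @ v # ws)))
      (lie_prod (u # v # us @ ws)) (lie_prod (v # u # us @ ws))" by simp
  moreover have "cong_sign (low A (length ((u # us) @ v # ws)))
      (lie_prod (u # us @ v # ws)) (lie_prod (u # v # us @ ws))"
    using Cons.prems cong_sign_left_normed_times[OF _ _ Cons.IH, of u A]
    by (simp add: block_words_Cons lie_prod_Cons)
  ultimately show ?case
    unfolding low_def append_Cons by (blast intro: cong_sign_trans)
qed

lemma lie_prod_permute:
  assumes "ws \<in> block_words A" "mset ws = mset vs"
  shows "cong_sign (low A (length ws)) (lie_prod ws) (lie_prod vs)"
  using assms
proof (induction vs arbitrary: ws A)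
  case Nil
  then have "ws = []" by simp
  then show ?case by (simp only: low_def cong_sign_refl)
next
  case (Cons v vs)
  then have "v \<in> set ws" by (metis list.set_intros(1) set_mset_mset)
  then obtain as bs where ws: "ws = as @ v # bs" by (meson split_list)
  have "v # as @ bs \<in> block_words A" "mset (as @ bs) = mset vs"
    using Cons.prems block_words_mset[of ws "v # as @ bs"] by (simp_all add: ws)
  then have "cong_sign (low A (length ws)) (lie_prod (v # as @ bs)) (lie_prod (v # vs))"
    using cong_sign_left_normed_times[OF _ _ Cons.IH, of v A "as @ bs"]
    by (simp add: block_words_Cons lie_prod_Cons ws)
  then show ?case
    using lie_prod_move_to_front[of as v bs A] Cons.prems(1)
    unfolding low_def ws by (blast intro: cong_sign_trans)
qed


section \<open>Unitriangular change of basis\<close>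

text \<open>One inclusion is immediate; for the other, solve for \<open>f i\<close> by induction on
  the rank.\<close>

lemma triangular_span:
  fixes rank :: "'i \<Rightarrow> nat"
  assumes tri: "\<And>i. i \<in> I \<Longrightarrow> cong_sign (frag.span (f ` {j \<in> I. rank j < rank i})) (g i) (f i)"
  shows "frag.span (g ` I) = frag.span (f ` I)"
proof
  have "g i \<in> frag.span (f ` I)" if "i \<in> I" for i
    using cong_sign_span_iff[OF tri[OF that], of "f ` I"] that
    by (auto intro: frag.span_base)
  then show "frag.span (g ` I) \<subseteq> frag.span (f ` I)"
    by (intro frag.span_minimal) auto
  have "f i \<in> frag.span (g ` I)" if "i \<in> I" for i
    using that
  proof (induction "rank i" arbitrary: i rule: less_induct)
    case less
    have "f ` {j \<in> I. rank j < rank i} \<subseteq> frag.span (g ` I)" using less.hyps by auto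
    moreover have "g i \<in> frag.span (g ` I)" using less.prems by (auto intro: frag.span_base)
    ultimately show ?case using cong_sign_span_iff[OF tri[OF less.prems]] by blast
  qed
  then show "frag.span (f ` I) \<subseteq> frag.span (g ` I)"
    by (intro frag.span_minimal) auto
qed

text \<open>In a relation among the \<open>g i\<close>, compare coordinates at \<open>f i\<close> for a term of maximal rank.\<close>

lemma triangular_independent:
  fixes rank :: "'i \<Rightarrow> nat"
  assumes tri: "\<And>i. i \<in> I \<Longrightarrow> cong_sign (frag.span (f ` {j \<in> I. rank j < rank i})) (g i) (f i)"
    and inj: "inj_on f I" and indep: "frag.independent (f ` I)"
  shows "frag.independent (g ` I)"
proof
  assume "frag.dependent (g ` I)"
  then obtain t u v where t: "finite t" "t \<subseteq> g ` I" "(\<Sum>v\<in>t. frag_cmul (u v) v) = 0"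
    and v: "v \<in> t" "u v \<noteq> 0"
    unfolding frag.dependent_explicit by blast
  \<comment> \<open>\<open>g\<close> is not known to be injective, so one index is chosen for each
    vector of the relation.\<close>
  obtain J where J: "J \<subseteq> I" "inj_on g J" "t = g ` J" using t(2) by (auto simp: subset_image_inj)
  have "finite J" using t(1) J by (simp add: finite_image_iff)
  have sum: "(\<Sum>j\<in>J. frag_cmul (u (g j)) (g j)) = 0" using t(3) J by (simp add: sum.reindex)
  define J' where "J' = {j \<in> J. u (g j) \<noteq> 0}"
  have J': "finite J'" "J' \<noteq> {}" using \<open>finite J\<close> v J by (auto simp: J'_def)
  then have "Max (rank ` J') \<in> rank ` J'" by simp
  then obtain i where i: "i \<in> J'" "rank i = Max (rank ` J')" by auto
  then have "i \<in> I" "i \<in> J" "u (g i) \<noteq> 0" using J by (auto simp: J'_def)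
  define \<phi> where "\<phi> x = frag.representation (f ` I) x (f i)" for x
  have span_g: "g j \<in> frag.span (f ` I)" if "j \<in> I" for j
    using triangular_span[OF tri] frag.span_base[of "g j" "g ` I"] that by auto
  have \<phi>_low: "\<phi> x = 0" if "x \<in> frag.span (f ` {j \<in> I. rank j < rank l})" "rank l \<le> rank i" for x l
  proof -
    \<comment> \<open>Injectivity of \<open>f\<close> enters here: otherwise an index of lower rank
      could give the same vector.\<close>
    have "f i \<notin> f ` {j \<in> I. rank j < rank l}"
    proof
      assume "f i \<in> f ` {j \<in> I. rank j < rank l}"
      then obtain j where "j \<in> I" "rank j < rank l" "f i = f j" by blast
      then show False using inj_onD[OF inj, of i j] \<open>i \<in> I\<close> that(2) by simp
    qed
    moreover have "\<phi> x = frag.representation (f ` {j \<in> I. rank j < rank l}) x (f i)"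
      unfolding \<phi>_def using that(1) indep by (subst frag.representation_extend) auto
    ultimately show ?thesis using frag.representation_ne_zero by metis
  qed
  have \<phi>_f: "\<phi> (f j) = (if j = i then 1 else 0)" if "j \<in> I" for j
    using that \<open>i \<in> I\<close> inj indep
    by (auto simp: \<phi>_def frag.representation_basis dest: inj_onD)
  have \<phi>_g: "\<phi> (g j) = \<phi> (f j) \<or> \<phi> (g j) = - \<phi> (f j)" if "j \<in> I" "rank j \<le> rank i" for j
  proof -
    have f: "f j \<in> frag.span (f ` I)" using that by (auto intro: frag.span_base)
    have "\<phi> (g j - f j) = \<phi> (g j) - \<phi> (f j)" "\<phi> (g j + f j) = \<phi> (g j) + \<phi> (f j)"
      unfolding \<phi>_def using indep span_g[OF that(1)] f
      by (simp_all add: frag.representation_diff frag.representation_add)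
    then show ?thesis
      using tri[OF that(1)] \<phi>_low[OF _ that(2)] unfolding cong_sign_def by fastforce
  qed
  have "u (g j) * \<phi> (g j) = 0" if "j \<in> J" "j \<noteq> i" for j
  proof (cases "u (g j) = 0")
    case False
    then have "rank j \<le> rank i" using that J' i by (auto simp: J'_def)
    then show ?thesis using \<phi>_g[of j] \<phi>_f[of j] that J(1) by auto
  qed simp
  then have "(\<Sum>j\<in>J. u (g j) * \<phi> (g j)) = (\<Sum>j\<in>J. if j = i then u (g i) * \<phi> (g i) else 0)"
    by (intro sum.cong) auto
  also have "\<dots> = u (g i) * \<phi> (g i)" using \<open>finite J\<close> \<open>i \<in> J\<close> by simp
  also have "\<dots> \<noteq> 0" using \<phi>_g[of i] \<phi>_f[of i] \<open>i \<in> I\<close> \<open>u (g i) \<noteq> 0\<close> by auto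
  also have "(\<Sum>j\<in>J. u (g j) * \<phi> (g j)) = \<phi> (\<Sum>j\<in>J. frag_cmul (u (g j)) (g j))"
  proof -
    have "\<phi> (frag_cmul (u (g j)) (g j)) = u (g j) * \<phi> (g j)" if "j \<in> J" for j
      unfolding \<phi>_def using indep span_g that J(1) by (subst frag.representation_scale) auto
    moreover have "\<phi> (\<Sum>j\<in>J. frag_cmul (u (g j)) (g j)) = (\<Sum>j\<in>J. \<phi> (frag_cmul (u (g j)) (g j)))"
      unfolding \<phi>_def using indep span_g J(1)
      by (subst frag.representation_sum) (auto intro: frag.span_scale)
    ultimately show ?thesis by simp
  qed
  finally show False by (simp add: sum \<phi>_def frag.representation_zero)
qed

section \<open>Sorting the factors by a key\<close>

lemma sorted_wrt_key_iff:
  fixes key :: "'b \<Rightarrow> int"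
  assumes "distinct ws" "inj_on key (set ws)"
  shows "sorted_wrt (\<lambda>u v. key u < key v) ws \<longleftrightarrow> sorted (map key ws)"
  using assms strict_sorted_iff[of "map key ws"] by (simp add: sorted_wrt_map distinct_map)

lemma distinct_block_words:
  assumes "ws \<in> block_words A"
  shows "distinct ws"
proof -
  have "[] \<notin> set ws" using assms by (auto simp: block_words_def)
  then have "removeAll [] ws = ws" by (rule removeAll_id)
  then show ?thesis using assms by (simp add: block_words_def distinct_concat_iff)
qed

lemma sort_block_words:
  fixes key :: "nat list \<Rightarrow> int"
  assumes "inj_on key (set ws)" "ws \<in> block_words A"
  shows "sort_key key ws \<in> {ws \<in> block_words A. sorted_wrt (\<lambda>u v. key u < key v) ws}"
proof -
  have "sort_key key ws \<in> block_words A"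
    using assms(2) block_words_mset[of "sort_key key ws" ws] by simp
  then show ?thesis
    using assms by (simp add: sorted_wrt_key_iff distinct_block_words)
qed

text \<open>Each product agrees up to sign with its sorted form modulo fewer factors, and those are
  handled by induction.\<close>

lemma low_subset_span_sorted:
  fixes key :: "nat list \<Rightarrow> int"
  assumes key: "\<And>ws. ws \<in> block_words A \<Longrightarrow> inj_on key (set ws)"
  shows "low A m \<subseteq> frag.span (lie_prod `
    {ws \<in> {ws \<in> block_words A. sorted_wrt (\<lambda>u v. key u < key v) ws}. length ws < m})"
    (is "_ \<subseteq> frag.span (lie_prod ` ?I m)")
proof (induction m rule: less_induct)
  case (less m)
  have "lie_prod ws \<in> frag.span (lie_prod ` ?I m)" if ws: "ws \<in> block_words A" "length ws < m" for ws
  proof -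
    have "low A (length ws) \<subseteq> frag.span (lie_prod ` ?I (length ws))" using less ws(2) by blast
    also have "\<dots> \<subseteq> frag.span (lie_prod ` ?I m)" using ws(2) by (intro frag.span_mono) auto
    finally have "lie_prod ` {vs \<in> block_words A. length vs < length ws}
        \<subseteq> frag.span (lie_prod ` ?I m)"
      unfolding low_def by (rule order_trans[OF frag.span_superset])
    moreover have "lie_prod (sort_key key ws) \<in> frag.span (lie_prod ` ?I m)"
      using sort_block_words[OF key[OF ws(1)] ws(1)] ws(2)
      by (intro frag.span_base imageI) simp
    ultimately show ?thesis
      using cong_sign_span_iff[OF lie_prod_permute[of ws A "sort_key key ws", unfolded low_def]] ws(1)
      by simp
  qed
  then show ?case unfolding low_def by (intro frag.span_minimal) auto
qed

text \<open>Re-sorting matches the two families of products, and by \<open>lie_prod_permute\<close>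
  the match is triangular with respect to \<open>length\<close>.\<close>

lemma basis_change:
  fixes key key' :: "nat list \<Rightarrow> int"
  assumes key: "\<And>ws. ws \<in> block_words A \<Longrightarrow> inj_on key (set ws)"
    and key': "\<And>ws. ws \<in> block_words A \<Longrightarrow> inj_on key' (set ws)"
    and inj: "inj_on lie_prod {ws \<in> block_words A. sorted_wrt (\<lambda>u v. key u < key v) ws}"
    and basis: "is_Z_basis (sorted_prods A key) M"
  shows "is_Z_basis (sorted_prods A key') M"
proof -
  let ?I = "{ws \<in> block_words A. sorted_wrt (\<lambda>u v. key u < key v) ws}"
  let ?g = "\<lambda>ws. lie_prod (sort_key key' ws)"
  have tri: "cong_sign (frag.span (lie_prod ` {vs \<in> ?I. length vs < length ws})) (?g ws) (lie_prod ws)"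
    if "ws \<in> ?I" for ws
  proof -
    have ws: "ws \<in> block_words A" using that by simp
    have "cong_sign (low A (length ws)) (?g ws) (lie_prod ws)"
      using lie_prod_permute[of "sort_key key' ws" A ws] sort_block_words[OF key'[OF ws] ws] by simp
    then show ?thesis
      using low_subset_span_sorted[OF key] by (rule cong_sign_mono)
  qed
  have "?g ` ?I = sorted_prods A key'"
  proof
    show "?g ` ?I \<subseteq> sorted_prods A key'"
    proof
      fix x assume "x \<in> ?g ` ?I"
      then obtain ws where ws: "ws \<in> block_words A" "x = ?g ws" by blast
      then show "x \<in> sorted_prods A key'"
        using sort_block_words[OF key'[OF ws(1)] ws(1)] unfolding sorted_prods_def by blast
    qed
    show "sorted_prods A key' \<subseteq> ?g ` ?I"
    proof
      fix x assume "x \<in> sorted_prods A key'"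
      then obtain vs where vs: "vs \<in> block_words A" "sorted_wrt (\<lambda>u v. key' u < key' v) vs"
        "x = lie_prod vs" unfolding sorted_prods_def by blast
      \<comment> \<open>\<open>key'\<close> is injective on the factors, so they have only one
        \<open>key'\<close>-sorted arrangement.\<close>
      have "sort_key key' (sort_key key vs) = vs"
        using key'[OF vs(1)] vs(1,2)
        by (intro sort_key_inj_key_eq) (simp_all add: sorted_wrt_key_iff distinct_block_words)
      then show "x \<in> ?g ` ?I"
        using imageI[OF sort_block_words[OF key[OF vs(1)] vs(1)], of ?g] vs(3) by simp
    qed
  qed
  moreover have "frag.independent (?g ` ?I)"
    using basis triangular_independent[where rank = length, OF tri inj]
    by (simp add: is_Z_basis_def sorted_prods_def)
  moreover have "frag.span (?g ` ?I) = M"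
    using basis triangular_span[where rank = length, OF tri]
    by (simp add: is_Z_basis_def sorted_prods_def)
  ultimately show ?thesis by (simp add: is_Z_basis_def)
qed


section \<open>The order on the basis brackets\<close>

text \<open>The bound excludes singletons, where \<open>lie_basis\<close> consists of the letter
  itself, which is not a cycle.\<close>

lemma lie_basis_eq:
  assumes "card S \<ge> 2"
  shows "lie_basis S = left_normed ` {w. lie_word w \<and> set w = S}"
proof -
  have S: "finite S" "S \<noteq> {}" using assms by (auto intro: card_ge_0_finite)
  have "foldl bracket (frag_of [Min S]) (map (\<lambda>a. frag_of [a]) as)
      \<in> left_normed ` {w. lie_word w \<and> set w = S}"
    if as: "distinct as" "set as = S - {Min S}" for as
  proof
    have "as \<noteq> []"
    proof
      assume "as = []"
      then have "S \<subseteq> {Min S}" using as(2) by auto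
      then have "card S \<le> card {Min S}" by (intro card_mono) auto
      with assms show False by simp
    qed
    moreover have "Min S < b" if "b \<in> set as" for b
      using that as(2) Min_le[OF S(1), of b] by (auto simp: order_less_le)
    moreover have "insert (Min S) (set as) = S" using as(2) Min_in[OF S] by blast
    ultimately show "Min S # as \<in> {w. lie_word w \<and> set w = S}" using as(1) by auto
  qed simp
  moreover have "left_normed w \<in> lie_basis S" if w: "lie_word w" "set w = S" for w
  proof (cases w)
    case (Cons a as)
    have "a \<le> y" if "y \<in> S" for y using lie_word_hd_le[OF w(1)] that Cons w(2) by auto
    then have "Min S = a" using S(1) w(2) Cons by (intro Min_eqI) auto
    moreover have "distinct as" "set as = S - {a}" using w Cons by auto
    ultimately show ?thesis unfolding lie_basis_def Cons by auto
  qed (use w in simp)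
  ultimately show ?thesis unfolding lie_basis_def by blast
qed

lemma card_set_lie_word: "lie_word w \<Longrightarrow> 2 \<le> card (set w)"
  using length_lie_word[of w] distinct_card[OF distinct_lie_word, of w] by simp

lemma all_lie_basis_eq: "all_lie_basis k = left_normed ` {w. lie_word w \<and> set w \<subseteq> {1..k}}"
  unfolding all_lie_basis_def using lie_basis_eq card_set_lie_word by auto

lemma finite_all_lie_basis: "finite (all_lie_basis k)"
  unfolding all_lie_basis_eq
  by (rule finite_imageI, rule finite_subset[OF _ finite_subset_distinct[of "{1..k}"]])
    (auto simp: distinct_lie_word)

text \<open>Counting the elements below turns an abstract order on a finite set into a numeric key
  for \<open>sort_key\<close>.\<close>

lemma linear_order_rank_less_iff:
  assumes r: "linear_order_on B r" and B: "finite B" "P \<in> B" "Q \<in> B"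
  shows "card {R \<in> B. (R, P) \<in> r} < card {R \<in> B. (R, Q) \<in> r} \<longleftrightarrow> (P, Q) \<in> r \<and> P \<noteq> Q"
proof -
  have r': "trans r" "antisym r" "total_on B r" "refl_on B r"
    using r by (simp_all add: order_on_defs)
  have mono: "{R \<in> B. (R, P) \<in> r} \<subseteq> {R \<in> B. (R, Q) \<in> r}" if "(P, Q) \<in> r" for P Q
    using r'(1) that by (blast dest: transD)
  show ?thesis
  proof
    assume less: "card {R \<in> B. (R, P) \<in> r} < card {R \<in> B. (R, Q) \<in> r}"
    then have "P \<noteq> Q" by auto
    moreover have "(Q, P) \<notin> r"
      using less card_mono[OF _ mono[of Q P]] B(1) by fastforce
    ultimately show "(P, Q) \<in> r \<and> P \<noteq> Q" using r'(3) B by (auto simp: total_on_def)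
  next
    assume PQ: "(P, Q) \<in> r \<and> P \<noteq> Q"
    have "Q \<in> {R \<in> B. (R, Q) \<in> r}" using r'(4) B(3) by (auto simp: refl_on_def)
    moreover have "Q \<notin> {R \<in> B. (R, P) \<in> r}" using r'(2) PQ by (auto dest: antisymD)
    ultimately have "{R \<in> B. (R, P) \<in> r} \<subset> {R \<in> B. (R, Q) \<in> r}" using mono[of P Q] PQ by blast
    then show "card {R \<in> B. (R, P) \<in> r} < card {R \<in> B. (R, Q) \<in> r}"
      using B(1) by (intro psubset_card_mono) auto
  qed
qed

lemma list_all2_lie_basis:
  assumes "list_all2 (\<lambda>P S. card S \<ge> 2 \<and> P \<in> lie_basis S) Ps Ss"
  shows "\<exists>ws. Ps = map left_normed ws \<and> Ss = map set ws \<and> (\<forall>w\<in>set ws. lie_word w)"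
  using assms
proof (induction rule: list_all2_induct)
  case (Cons P Ps S Ss)
  then obtain ws where ws: "Ps = map left_normed ws" "Ss = map set ws" "\<forall>w\<in>set ws. lie_word w"
    by blast
  obtain w where "P = left_normed w" "S = set w" "lie_word w"
    using Cons(1) lie_basis_eq by blast
  with ws show ?case by (intro exI[of _ "w # ws"]) simp
qed simp

lemma increasing_products_eq:
  "increasing_products k r = lie_prod ` {ws \<in> block_words {1..k}.
     sorted_wrt (\<lambda>u v. (left_normed u, left_normed v) \<in> r \<and> left_normed u \<noteq> left_normed v) ws}"
    (is "_ = lie_prod ` ?W")
proof
  show "increasing_products k r \<subseteq> lie_prod ` ?W"
  proof
    fix x assume "x \<in> increasing_products k r"
    then obtain Ps Ss where x: "x = prod_list Ps" "ordered_partition {1..k} Ss"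
      "list_all2 (\<lambda>P S. card S \<ge> 2 \<and> P \<in> lie_basis S) Ps Ss"
      "sorted_wrt (\<lambda>P Q. (P, Q) \<in> r \<and> P \<noteq> Q) Ps"
      unfolding increasing_products_def by blast
    obtain ws where ws: "Ps = map left_normed ws" "Ss = map set ws" "\<forall>w\<in>set ws. lie_word w"
      using list_all2_lie_basis[OF x(3)] by blast
    have "ws \<in> ?W"
      using x(2,4) ws ordered_partition_map_set[OF ws(3)]
      by (simp add: block_words_def sorted_wrt_map)
    moreover have "x = lie_prod ws" using x(1) ws(1) by (simp add: lie_prod_def)
    ultimately show "x \<in> lie_prod ` ?W" by blast
  qed
  show "lie_prod ` ?W \<subseteq> increasing_products k r"
  proof
    fix x assume "x \<in> lie_prod ` ?W"
    then obtain ws where ws: "ws \<in> ?W" "x = lie_prod ws" by blast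
    then have lie: "\<forall>w\<in>set ws. lie_word w" by (simp add: block_words_def)
    have "ordered_partition {1..k} (map set ws)"
      using ws(1) unfolding ordered_partition_map_set[OF lie] by (simp add: block_words_def)
    moreover have "list_all2 (\<lambda>P S. card S \<ge> 2 \<and> P \<in> lie_basis S) (map left_normed ws) (map set ws)"
      using lie by (simp add: list_all2_map1 list_all2_map2 list_all2_same card_set_lie_word
          lie_basis_eq)
    moreover have "sorted_wrt (\<lambda>P Q. (P, Q) \<in> r \<and> P \<noteq> Q) (map left_normed ws)"
      using ws(1) by (simp add: sorted_wrt_map)
    ultimately show "x \<in> increasing_products k r"
      using ws(2) unfolding increasing_products_def lie_prod_def by blast
  qed
qed

lemma increasing_products_basis:
  assumes r: "linear_order_on (all_lie_basis k) r"
  shows "is_Z_basis (increasing_products k r) (top_cycles k)"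
proof -
  define key where "key w = int (card {R \<in> all_lie_basis k. (R, left_normed w) \<in> r})" for w
  have key_less: "key u < key v \<longleftrightarrow>
      (left_normed u, left_normed v) \<in> r \<and> left_normed u \<noteq> left_normed v"
    if "lie_word u" "lie_word v" "set u \<subseteq> {1..k}" "set v \<subseteq> {1..k}" for u v
    unfolding key_def of_nat_less_iff
    by (rule linear_order_rank_less_iff[OF r finite_all_lie_basis])
      (use that in \<open>auto simp: all_lie_basis_eq\<close>)
  have total: "(left_normed u, left_normed v) \<in> r \<or> (left_normed v, left_normed u) \<in> r"
    if "lie_word u" "lie_word v" "set u \<subseteq> {1..k}" "set v \<subseteq> {1..k}" "left_normed u \<noteq> left_normed v"
    for u v
    using r that by (auto simp: order_on_defs total_on_def all_lie_basis_eq)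
  have block: "lie_word u \<and> set u \<subseteq> {1..k}" if "ws \<in> block_words {1..k}" "u \<in> set ws" for ws u
    using that by (auto simp: block_words_def)
  have "is_Z_basis (sorted_prods {1..k} key) (top_cycles k)"
  proof (rule basis_change[OF _ _ inj_on_lie_prod_decreasing decreasing_basis])
    fix ws assume ws: "ws \<in> block_words {1..k}"
    \<comment> \<open>Factors of one product have disjoint letters, hence different first
      letters.\<close>
    show "inj_on (\<lambda>w. - int (hd w)) (set ws)"
    proof (rule inj_onI)
      fix u v assume uv: "u \<in> set ws" "v \<in> set ws" "- int (hd u) = - int (hd v)"
      then have "u \<noteq> []" "v \<noteq> []" using block[OF ws] by force+
      then have "hd u \<in> set u \<inter> set v" using uv(3) hd_in_set[of u] hd_in_set[of v] by simp
      moreover have "u \<noteq> v \<Longrightarrow> set u \<inter> set v = {}"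
        using ws uv(1,2) unfolding block_words_def distinct_concat_iff by blast
      ultimately show "u = v" by blast
    qed
    \<comment> \<open>Equal ranks mean equal brackets, and a bracket determines its word as its
      leading word.\<close>
    show "inj_on key (set ws)"
    proof (rule inj_onI)
      fix u v assume uv: "u \<in> set ws" "v \<in> set ws" "key u = key v"
      then have "left_normed u = left_normed v"
        using key_less[of u v] key_less[of v u] total[of u v] block[OF ws] by force
      then show "u = v"
        using has_lead_left_normed block[OF ws] uv(1,2) has_lead_unique by metis
    qed
  qed
  moreover have "sorted_prods {1..k} key = increasing_products k r"
  proof -
    have "sorted_wrt (\<lambda>u v. key u < key v) ws \<longleftrightarrow>
        sorted_wrt (\<lambda>u v. (left_normed u, left_normed v) \<in> r \<and> left_normed u \<noteq> left_normed v) ws"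
      if "ws \<in> block_words {1..k}" for ws
      using key_less block[OF that] by (intro iffI; elim sorted_wrt_mono_rel[rotated]) blast+
    then show ?thesis
      unfolding sorted_prods_def increasing_products_eq by (metis (mono_tags, lifting) Collect_cong)
  qed
  ultimately show ?thesis by simp
qed


section \<open>Top homology\<close>

text \<open>A chain one degree higher would need words with \<open>k + 1\<close> distinct
  letters.\<close>

lemma boundaries_top: "boundaries k (int k - 1) = {0}"
proof -
  have "inj_words k (int k) = {}"
  proof (rule ccontr)
    assume "inj_words k (int k) \<noteq> {}"
    then obtain w where w: "distinct w" "set w \<subseteq> {1..k}" "int (length w) = int k + 1"
      by (auto simp: inj_words_def)
    then have "length w \<le> k" using card_mono[of "{1..k}" "set w"] by (simp add: distinct_card)
    with w(3) show False by simp
  qed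
  then have "carrier (chain_gp k (int k - 1 + 1)) = {0}" by auto
  then show ?thesis by (simp add: boundaries_def)
qed

lemma group_cycle_gp: "group (cycle_gp k q)"
  unfolding cycle_gp_def
proof (rule subgroup.subgroup_is_group)
  show "subgroup (cycles k q) (chain_gp k q)"
  proof (rule subgroup.intro)
    show "x \<otimes>\<^bsub>chain_gp k q\<^esub> y \<in> cycles k q" if "x \<in> cycles k q" "y \<in> cycles k q" for x y
      using that keys_add[of x y] by (auto simp: cycles_def boundary_add)
  qed (auto simp: cycles_def boundary_minus)
qed simp

lemma iso_quotient_trivial:
  assumes "group G"
  shows "(\<lambda>x. {\<one>\<^bsub>G\<^esub>} #>\<^bsub>G\<^esub> x) \<in> iso G (G Mod {\<one>\<^bsub>G\<^esub>})"
proof (rule isoI)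
  interpret group G by fact
  show "(\<lambda>x. {\<one>\<^bsub>G\<^esub>} #>\<^bsub>G\<^esub> x) \<in> hom G (G Mod {\<one>\<^bsub>G\<^esub>})"
    using one_is_normal by (rule normal.r_coset_hom_Mod)
  have "{\<one>\<^bsub>G\<^esub>} #>\<^bsub>G\<^esub> x = {x}" if "x \<in> carrier G" for x
    using that by (simp add: r_coset_def)
  then show "bij_betw (\<lambda>x. {\<one>\<^bsub>G\<^esub>} #>\<^bsub>G\<^esub> x) (carrier G) (carrier (G Mod {\<one>\<^bsub>G\<^esub>}))"
    by (auto simp: bij_betw_def inj_on_def carrier_FactGroup)
qed

theorem theorem2p40:
  fixes k :: nat
  assumes "k \<ge> 2"
  shows "(\<lambda>P. boundaries k (int k - 1) #>\<^bsub>cycle_gp k (int k - 1)\<^esub> P)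
           \<in> iso (cycle_gp k (int k - 1)) (homology_gp k (int k - 1)) \<and>
         top_cycles k = frag.span (lie_products k) \<and>
         (\<forall>r. linear_order_on (all_lie_basis k) r \<longrightarrow>
           is_Z_basis (increasing_products k r) (top_cycles k))"
proof (intro conjI allI impI)
  have one: "\<one>\<^bsub>cycle_gp k (int k - 1)\<^esub> = 0" by (simp add: cycle_gp_def)
  show "(\<lambda>P. boundaries k (int k - 1) #>\<^bsub>cycle_gp k (int k - 1)\<^esub> P)
      \<in> iso (cycle_gp k (int k - 1)) (homology_gp k (int k - 1))"
    using iso_quotient_trivial[OF group_cycle_gp[of k "int k - 1"]]
    by (simp add: homology_gp_def boundaries_top one)
  \<comment> \<open>A basis made of Lie products yields the harder inclusion.\<close>
  have "sorted_prods {1..k} (\<lambda>w. - int (hd w)) \<subseteq> lie_products k"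
    using lie_prod_in_lie_products by (auto simp: sorted_prods_def)
  then have "top_cycles k \<subseteq> frag.span (lie_products k)"
    using decreasing_basis[of k] frag.span_mono by (metis is_Z_basis_def)
  moreover have "frag.span (lie_products k) \<subseteq> top_cycles k"
    using frag.span_mono[OF lie_products_subset_cycles] by (simp add: span_top_cycles)
  ultimately show "top_cycles k = frag.span (lie_products k)" by blast
qed (rule increasing_products_basis)

end
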